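(* Each of the four groups $\mathrm{PGL}_2(O_3)$, $\mathrm{PSL}_2(O_3)$, $\mathrm{PSL}_2(O_7)$ and $\mathrm{PSL}_2(O_{11})$ is a Jørgensen group of parabolic type that is not conjugate in $\mathrm{PSL}_2(\mathbb{C})$ to any Jørgensen group of parabolic type $(\theta,k)$. In particular, it is not true that every Jørgensen group of parabolic type is conjugate in $\mathrm{PSL}_2(\mathbb{C})$ to a Jørgensen group of parabolic type $(\theta,k)$.
   Context: A Kleinian group is a discrete subgroup of $\mathrm{PSL}_2(\mathbb{C})$; elements are written as matrices up to sign. For $X,Y\in\mathrm{PSL}_2(\mathbb{C})$ put $J(X,Y)=|\operatorname{tr}^2X-4|+|\operatorname{tr}[X,Y]-2|$. For a non-elementary Kleinian group $\Gamma$ that can be generated by two elements, $J(\Gamma)=\inf\{J(X,Y):\langle X,Y\rangle=\Gamma\}$; always $J(\Gamma)\ge1$, and $\Gamma$ is a Jørgensen group if $J(\Gamma)=1$. A Jørgensen group is of parabolic type if $\Gamma=\langle X,Y\rangle$ for some $X,Y$ with $J(X,Y)=1$ and $X$ parabolic. A Jørgensen group is of parabolic type $(\theta,k)$, where $0\le\theta\le2\pi$ and $k\in\mathbb{R}$, if it is the group generated by $\begin{pmatrix}1&1\\0&1\end{pmatrix}$ and $\begin{pmatrix}ke^{i\theta}&ik^2e^{i\theta}-ie^{-i\theta}\\-ie^{i\theta}&ke^{i\theta}\end{pmatrix}$. $O_d$ is the ring of integers of $\mathbb{Q}(\sqrt{-d})$, and $\mathrm{PGL}_2(O_d)$ is regarded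 as a subgroup of $\mathrm{PSL}_2(\mathbb{C})=\mathrm{PGL}_2(\mathbb{C})$. *)

theory Defs
  imports
    "HOL-Analysis.Analysis"
    "HOL-Algebra.Generated_Groups"
    "HOL-Computational_Algebra.Polynomial"
begin

section \<open>The group PSL(2,C)\<close>

type_synonym cmat2 = "complex ^ 2 ^ 2"

definition mat2 :: "complex \<Rightarrow> complex \<Rightarrow> complex \<Rightarrow> complex \<Rightarrow> cmat2" where
  "mat2 a b c d = vector [vector [a, b], vector [c, d]]"

definition SL2C :: "cmat2 monoid" where
  "SL2C = \<lparr>carrier = {A. det A = 1}, mult = (**), one = mat 1\<rparr>"

definition PSL2C :: "cmat2 set monoid" where
  "PSL2C = SL2C Mod {mat 1, - mat 1}"

definition psl :: "cmat2 \<Rightarrow> cmat2 set" where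
  "psl A = {mat 1, - mat 1} #>\<^bsub>SL2C\<^esub> A"

text \<open>The quotient topology; \<open>SL2C\<close> has the subspace topology of the space of all matrices.\<close>

definition PSL2C_topology :: "cmat2 set topology" where
  "PSL2C_topology = topology (\<lambda>U. U \<subseteq> carrier PSL2C \<and>
     openin (top_of_set (carrier SL2C)) {A \<in> carrier SL2C. psl A \<in> U})"

definition conjugate_subgroups :: "cmat2 set set \<Rightarrow> cmat2 set set \<Rightarrow> bool" where
  "conjugate_subgroups G H \<longleftrightarrow>
     (\<exists>g \<in> carrier PSL2C. H = (\<lambda>x. g \<otimes>\<^bsub>PSL2C\<^esub> x \<otimes>\<^bsub>PSL2C\<^esub> inv\<^bsub>PSL2C\<^esub> g) ` G)"


section \<open>Kleinian groups\<close>

definition kleinian_group :: "cmat2 set set \<Rightarrow> bool" where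
  "kleinian_group G \<longleftrightarrow>
     subgroup G PSL2C \<and> subtopology PSL2C_topology G = discrete_topology G"

text \<open>
  Action on the Riemann sphere, where \<open>None\<close> is the point at infinity, and its Poincare extension
  to the upper half-space, a point of which is a pair \<open>(z, t)\<close> with \<open>t > 0\<close>.
\<close>

definition moebius_sphere :: "cmat2 \<Rightarrow> complex option \<Rightarrow> complex option" where
  "moebius_sphere A p = (case p of
     None \<Rightarrow> if A$2$1 = 0 then None else Some (A$1$1 / A$2$1)
   | Some z \<Rightarrow> if A$2$1 * z + A$2$2 = 0 then None
               else Some ((A$1$1 * z + A$1$2) / (A$2$1 * z + A$2$2)))"

definition moebius_space :: "cmat2 \<Rightarrow> complex \<times> real \<Rightarrow> complex \<times> real" where
  "moebius_space A p = (case p of (z, t) \<Rightarrow>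
     let n = (cmod (A$2$1 * z + A$2$2))\<^sup>2 + (cmod (A$2$1))\<^sup>2 * t\<^sup>2
     in (((A$1$1 * z + A$1$2) * cnj (A$2$1 * z + A$2$2) + A$1$1 * cnj (A$2$1) * of_real (t\<^sup>2))
           / of_real n,
         t / n))"

text \<open>
  A group is elementary if it has a finite orbit in the closed hyperbolic space (Beardon).
  For discrete groups this agrees with the limit set having at most two points.
\<close>

definition elementary_group :: "cmat2 set set \<Rightarrow> bool" where
  "elementary_group G \<longleftrightarrow>
     (\<exists>p. finite {moebius_sphere A p | A. A \<in> carrier SL2C \<and> psl A \<in> G}) \<or>
     (\<exists>z t. t > 0 \<and> finite {moebius_space A (z, t) | A. A \<in> carrier SL2C \<and> psl A \<in> G})"


section \<open>Jorgensen groups\<close>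

text \<open>
  The functions and predicates on elements of PSL(2,C) are given on matrix representatives;
  they do not depend on the choice of signs (see \<open>jorgensen_J_uminus\<close>, \<open>parabolic_uminus\<close>).
\<close>

definition jorgensen_J :: "cmat2 \<Rightarrow> cmat2 \<Rightarrow> real" where
  "jorgensen_J X Y =
     cmod ((trace X)\<^sup>2 - 4) + cmod (trace (X ** Y ** matrix_inv X ** matrix_inv Y) - 2)"

definition generating_pair :: "cmat2 set set \<Rightarrow> cmat2 \<Rightarrow> cmat2 \<Rightarrow> bool" where
  "generating_pair G X Y \<longleftrightarrow>
     X \<in> carrier SL2C \<and> Y \<in> carrier SL2C \<and> generate PSL2C {psl X, psl Y} = G"

definition jorgensen_number :: "cmat2 set set \<Rightarrow> real" where
  "jorgensen_number G = Inf {jorgensen_J X Y | X Y. generating_pair G X Y}"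

definition jorgensen_group :: "cmat2 set set \<Rightarrow> bool" where
  "jorgensen_group G \<longleftrightarrow>
     kleinian_group G \<and> \<not> elementary_group G \<and> (\<exists>X Y. generating_pair G X Y) \<and>
     jorgensen_number G = 1"

definition parabolic :: "cmat2 \<Rightarrow> bool" where
  "parabolic X \<longleftrightarrow> det X = 1 \<and> X \<noteq> mat 1 \<and> X \<noteq> - mat 1 \<and> (trace X)\<^sup>2 = 4"

definition jorgensen_parabolic_type :: "cmat2 set set \<Rightarrow> bool" where
  "jorgensen_parabolic_type G \<longleftrightarrow>
     jorgensen_group G \<and> (\<exists>X Y. generating_pair G X Y \<and> jorgensen_J X Y = 1 \<and> parabolic X)"

definition jorgensen_parabolic_type_params :: "real \<Rightarrow> real \<Rightarrow> cmat2 set set \<Rightarrow> bool" where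
  "jorgensen_parabolic_type_params \<theta> k G \<longleftrightarrow>
     0 \<le> \<theta> \<and> \<theta> \<le> 2 * pi \<and> jorgensen_group G \<and>
     G = generate PSL2C
       {psl (mat2 1 1 0 1),
        psl (mat2 (of_real k * exp (\<i> * of_real \<theta>))
                  (\<i> * (of_real k)\<^sup>2 * exp (\<i> * of_real \<theta>) - \<i> * exp (- (\<i> * of_real \<theta>)))
                  (- \<i> * exp (\<i> * of_real \<theta>))
                  (of_real k * exp (\<i> * of_real \<theta>)))}"


section \<open>Groups over rings of integers of imaginary quadratic fields\<close>

definition imag_quadratic_field :: "nat \<Rightarrow> complex set" where
  "imag_quadratic_field d = {a + b * (\<i> * of_real (sqrt (real d))) | a b. a \<in> \<rat> \<and> b \<in> \<rat>}"

definition ring_of_ints :: "nat \<Rightarrow> complex set" where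
  "ring_of_ints d = {x \<in> imag_quadratic_field d. algebraic_int x}"

definition SL2_O :: "nat \<Rightarrow> cmat2 set" where
  "SL2_O d = {A. (\<forall>i j. A$i$j \<in> ring_of_ints d) \<and> det A = 1}"

definition GL2_O :: "nat \<Rightarrow> cmat2 set" where
  "GL2_O d = {A. (\<forall>i j. A$i$j \<in> ring_of_ints d) \<and> (\<exists>u \<in> ring_of_ints d. det A * u = 1)}"

definition PSL2_O :: "nat \<Rightarrow> cmat2 set set" where
  "PSL2_O d = psl ` SL2_O d"

text \<open>
  Under the identification of PSL(2,C) with PGL(2,C), a matrix \<open>A\<close> of determinant 1 represents an
  element of PGL(2,O) iff it is a complex scalar multiple of some matrix in GL(2,O).
\<close>

definition PGL2_O :: "nat \<Rightarrow> cmat2 set set" where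
  "PGL2_O d = {psl A | A. A \<in> carrier SL2C \<and> (\<exists>l. \<exists>B \<in> GL2_O d. A = mat l ** B)}"


section \<open>Basic facts\<close>

lemma carrier_SL2C [simp]: "A \<in> carrier SL2C \<longleftrightarrow> det A = 1"
  and mult_SL2C [simp]: "mult SL2C = (**)"
  and one_SL2C [simp]: "one SL2C = mat 1"
  by (auto simp: SL2C_def)

lemma matrix_mult_uminus:
  "(- A) ** B = - (A ** (B :: cmat2))" "A ** (- B) = - (A ** (B :: cmat2))"
  by (simp_all add: vec_eq_iff matrix_matrix_mult_def sum_2 forall_2)

lemma det_uminus_cmat2 [simp]: "det (- A) = det (A :: cmat2)"
  by (simp add: det_2)

lemma group_SL2C: "group SL2C"
proof (rule groupI)
  fix A assume "A \<in> carrier SL2C"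
  hence d: "det A = 1" by simp
  hence "invertible A" by (simp add: invertible_det_nz)
  then obtain B where B: "B ** A = mat 1" by (auto simp: invertible_def)
  have "det B = 1" using arg_cong[OF B, of det] d by (simp add: det_mul)
  with B show "\<exists>B \<in> carrier SL2C. B \<otimes>\<^bsub>SL2C\<^esub> A = \<one>\<^bsub>SL2C\<^esub>" by auto
qed (auto simp: det_mul matrix_mul_assoc)

lemma normal_center: "{mat 1, - mat 1} \<lhd> SL2C"
proof -
  interpret group SL2C by (rule group_SL2C)
  have inv_neg: "inv\<^bsub>SL2C\<^esub> (- mat 1) = - mat 1"
    by (rule inv_equality) (auto simp: matrix_mult_uminus)
  have "subgroup {mat 1, - mat 1} SL2C"
    using inv_neg inv_one by (unfold_locales) (auto simp: matrix_mult_uminus)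
  moreover have "\<forall>x \<in> carrier SL2C. {mat 1, - mat 1} #>\<^bsub>SL2C\<^esub> x = x <#\<^bsub>SL2C\<^esub> {mat 1, - mat 1}"
    by (auto simp: r_coset_def l_coset_def matrix_mult_uminus)
  ultimately show ?thesis by (rule normalI)
qed

lemma group_PSL2C: "group PSL2C"
  unfolding PSL2C_def by (rule normal.factorgroup_is_group[OF normal_center])

lemma psl_eq: "psl A = {A, - A}"
  by (auto simp: psl_def r_coset_def matrix_mult_uminus)

lemma carrier_PSL2C: "carrier PSL2C = psl ` carrier SL2C"
  by (auto simp: PSL2C_def carrier_FactGroup psl_def)

lemma psl_mult:
  assumes "A \<in> carrier SL2C" "B \<in> carrier SL2C"
  shows "psl A \<otimes>\<^bsub>PSL2C\<^esub> psl B = psl (A ** B)"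
  using normal.rcos_sum[OF normal_center assms] by (simp add: PSL2C_def psl_def)

lemma openin_PSL2C_topology:
  "openin PSL2C_topology U \<longleftrightarrow> U \<subseteq> carrier PSL2C \<and>
     openin (top_of_set (carrier SL2C)) {A \<in> carrier SL2C. psl A \<in> U}"
proof -
  have "istopology (\<lambda>U. U \<subseteq> carrier PSL2C \<and>
     openin (top_of_set (carrier SL2C)) {A \<in> carrier SL2C. psl A \<in> U})" (is "istopology ?P")
    unfolding istopology_def
  proof (intro conjI allI impI)
    fix S T assume "?P S" "?P T"
    hence "openin (top_of_set (carrier SL2C))
             ({A \<in> carrier SL2C. psl A \<in> S} \<inter> {A \<in> carrier SL2C. psl A \<in> T})"
      by blast
    thus "openin (top_of_set (carrier SL2C)) {A \<in> carrier SL2C. psl A \<in> S \<inter> T}"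
      by (rule back_subst[where P = "openin _"]) auto
    show "S \<inter> T \<subseteq> carrier PSL2C" using \<open>?P S\<close> by auto
  next
    fix K assume K: "\<forall>S\<in>K. ?P S"
    hence "openin (top_of_set (carrier SL2C)) (\<Union>S\<in>K. {A \<in> carrier SL2C. psl A \<in> S})"
      by (intro openin_Union) auto
    thus "openin (top_of_set (carrier SL2C)) {A \<in> carrier SL2C. psl A \<in> \<Union>K}"
      by (rule back_subst[where P = "openin _"]) auto
    show "\<Union>K \<subseteq> carrier PSL2C" using K by auto
  qed
  thus ?thesis by (simp add: PSL2C_topology_def)
qed

lemma matrix_inv_cmat2:
  assumes "invertible (A :: cmat2)"
  shows "matrix_inv A ** A = mat 1" "A ** matrix_inv A = mat 1"
  using someI_ex[OF assms[unfolded invertible_def]] by (simp_all add: matrix_inv_def)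

lemma matrix_inv_uminus:
  assumes "det (A :: cmat2) = 1"
  shows "matrix_inv (- A) = - matrix_inv A"
proof -
  have A: "invertible A" and nA: "invertible (- A)"
    using assms by (simp_all add: invertible_det_nz)
  have "matrix_inv (- A) = matrix_inv (- A) ** ((- A) ** (- matrix_inv A))"
    using A by (simp add: matrix_mult_uminus matrix_inv_cmat2(2))
  also have "\<dots> = - matrix_inv A"
    using nA by (simp only: matrix_mul_assoc matrix_inv_cmat2(1) matrix_mul_lid)
  finally show ?thesis .
qed

lemma trace_uminus_cmat2: "trace (- A) = - trace (A :: cmat2)"
  by (simp add: trace_def sum_2)

lemma jorgensen_J_uminus:
  assumes "det X = 1" "det Y = 1"
  shows "jorgensen_J (- X) Y = jorgensen_J X Y" "jorgensen_J X (- Y) = jorgensen_J X Y"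
  using assms
  by (simp_all add: jorgensen_J_def matrix_inv_uminus matrix_mult_uminus trace_uminus_cmat2)

lemma parabolic_uminus: "parabolic (- X) \<longleftrightarrow> parabolic X"
  by (auto simp: parabolic_def trace_uminus_cmat2 minus_equation_iff[of X])

end

theory Submission
  imports Defs
begin

text \<open>
  Write \<open>O\<close> for the ring of integers of the field in question, \<open>\<omega> = (1 + \<surd>-d) / 2\<close> and
  \<open>T = (1, 1; 0, 1)\<close>.  Since \<open>d\<close> is 3, 7 or 11, \<open>O = \<int> + \<int>\<omega>\<close>.

  The groups are Jorgensen groups because \<open>O\<close> is discrete and norm-Euclidean.  All matrices in
  question have the form \<open>l M\<close> with \<open>l\<^sup>4 = 1\<close> and \<open>M\<close> over \<open>O\<close> (for \<open>PGL\<^sub>2(O\<^sub>3)\<close> this holds because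
  every unit of \<open>O\<^sub>3\<close> is a square up to sign), so the squares of their entries lie in \<open>O\<close>
  and the groups are discrete.  For the same reason \<open>tr\<^sup>2 X - 4\<close> and \<open>tr [X,Y] - 2\<close> lie in \<open>O\<close>, where
  nonzero elements have absolute value at least 1.  Hence \<open>J(X,Y) < 1\<close> forces both to vanish, and
  then \<open>X\<close> and \<open>Y\<close> have a common eigenvector (\<open>common_invariant_line\<close>), which is impossible for
  generators of a group containing \<open>PSL\<^sub>2(\<int>)\<close>.  This arithmetic argument replaces Jorgensen's
  inequality.  The bound 1 is attained because two elements suffice to generate: \<open>T\<close> together with
  \<open>(\<omega>, -1; 1, 0)\<close> generates \<open>PSL\<^sub>2(O)\<close>, and \<open>T\<close> together with \<open>i (\<omega>, 1; 1, 0)\<close> generates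
  \<open>PGL\<^sub>2(O\<^sub>3)\<close>; the Euclidean algorithm (\<open>PSL2_O_subset_if_generators\<close>) reduces this to a few
  words in the generators.

  Conjugation preserves traces.  Suppose that a group \<open>H\<close> of type \<open>(\<theta>,k)\<close>, with second generator
  \<open>B\<close>, is conjugate to one of the four groups, and let \<open>c\<close> be the lower left entry of \<open>B\<close>.  The
  traces \<open>tr (T\<^sup>n B) = tr B + n c\<close> lie in \<open>O \<union> i O\<close>, so \<open>c = l u\<close> with \<open>u\<close> a unit of \<open>O\<close> and
  \<open>l\<^sup>4 = 1\<close>.  The special shape of \<open>B\<close>, namely \<open>tr B = 2 i k c\<close>, then gives \<open>tr B = l m \<surd>-d u\<close> with
  an integer \<open>m\<close>: real multiples of \<open>i\<close> in \<open>O\<close> are integer multiples of \<open>\<surd>-d\<close>.  After a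
  translation, \<open>B\<close> becomes \<open>l (m \<surd>-d u, \<plusminus> u\<^sup>-\<^sup>1; u, 0)\<close>.

  If \<open>u = \<plusminus>1\<close>, then the translate of \<open>H\<close> consists of matrices over the proper subring \<open>\<int>[\<surd>-d]\<close>, up to fourth
  roots of unity, and \<open>\<omega>\<close> is
  not the trace of any element of \<open>H\<close>, although it is the trace of an element of \<open>PSL\<^sub>2(O)\<close>.

  Otherwise \<open>d = 3\<close> and \<open>u\<close> is \<open>\<plusminus>\<omega>\<close> or its conjugate.  As \<open>\<surd>-3\<close> is congruent to 1 modulo 2, both
  \<open>T\<close> and one of \<open>B\<close>, \<open>T B\<close> reduce to involutions over \<open>O / 2 = F\<^sub>4\<close>, and \<open>H\<close> reduces to a dihedral
  group of order 10.  That group is the orthogonal group of the anisotropic form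
  \<open>x\<^sup>2 + x y + u\<^sup>-\<^sup>2 y\<^sup>2\<close>, and it has no element of order 3, that is, of trace 1
  (\<open>no_isometry_of_trace_1\<close>).  But \<open>PSL\<^sub>2(O)\<close> has elements of trace 1.
\<close>

section \<open>Integers of imaginary quadratic fields\<close>

lemma algebraic_int_monic_quadratic:
  fixes x :: "'a :: field"
  assumes "x^2 + of_int b * x + of_int c = 0"
  shows "algebraic_int x"
proof (rule algebraic_int.intros)
  show "lead_coeff [:of_int c, of_int b, 1 :: 'a:] = 1" by simp
  show "\<forall>i. coeff [:of_int c, of_int b, 1 :: 'a:] i \<in> \<int>"
    by (auto simp: coeff_pCons split: nat.splits)
  show "poly [:of_int c, of_int b, 1 :: 'a:] x = 0"
    using assms by (simp add: algebra_simps power2_eq_square)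
qed

lemma poly_nonreal_root_imp_degree_ge_2:
  fixes r :: "int poly"
  assumes "poly (map_poly of_int r) (x::complex) = 0" "Im x \<noteq> 0" "degree r < 2"
  shows "r = 0"
proof -
  obtain u v where r: "r = [:u, v:]"
  proof -
    have "r = [:coeff r 0, coeff r 1:]"
      using assms(3) by (intro poly_eqI) (auto simp: coeff_pCons coeff_eq_0 split: nat.splits)
    thus ?thesis using that by blast
  qed
  have e: "of_int u + x * of_int v = 0"
    using assms(1) by (simp add: r map_poly_pCons)
  have "Im x * of_int v = 0" using arg_cong[OF e, of Im] by simp
  hence "v = 0" using assms(2) by simp
  with e show ?thesis by (simp add: r)
qed

text \<open>By Gauss's lemma the primitive polynomial \<open>q\<close> of the quadratic divides a monic integer polynomial
  \<open>p\<close> with root \<open>x\<close> over the integers, so \<open>q\<close> is monic up to sign.  Division is replaced by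
  pseudo-division, whose remainder is linear with a nonreal root and hence zero; comparing contents
  then removes the factor \<open>k\<close> that it introduces.\<close>

lemma algebraic_int_nonreal_quadratic:
  fixes x :: complex and a b c :: int
  assumes "algebraic_int x" "Im x \<noteq> 0" and a: "a > 0"
    and root: "of_int a * x^2 + of_int b * x + of_int c = 0"
  shows "a dvd b" "a dvd c"
proof -
  obtain p where p: "poly (map_poly of_int p) x = 0" "lead_coeff p = 1"
    using assms(1) by (auto simp: algebraic_int_altdef_ipoly)
  define q1 where "q1 = [:c, b, a:]"
  define q where "q = primitive_part q1"
  have q1: "q1 = smult (content q1) q" by (simp add: q_def)
  have q1_0: "q1 \<noteq> 0" using a by (simp add: q1_def)
  have c0: "content q1 > 0"
    using q1_0 content_eq_zero_iff[of q1] by (metis normalize_content abs_ge_zero normalize_int_def order_less_le)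
  have degq: "degree q = 2" using a by (simp add: q_def q1_def)
  have q0: "q \<noteq> 0" using degq by auto
  have cq: "content q = 1" using q1_0 by (simp add: q_def)
  have hom: "poly (map_poly of_int (f * g)) x = poly (map_poly of_int f) x * poly (map_poly of_int g) x"
    for f g :: "int poly"
  proof -
    have "map_poly of_int (f * g) = (map_poly of_int f * map_poly of_int g :: complex poly)"
      by (intro poly_eqI) (simp add: coeff_map_poly coeff_mult)
    thus ?thesis by simp
  qed
  have homa: "poly (map_poly of_int (f + g)) x = poly (map_poly of_int f) x + poly (map_poly of_int g) x"
    for f g :: "int poly"
  proof -
    have "map_poly of_int (f + g) = (map_poly of_int f + map_poly of_int g :: complex poly)"
      by (intro poly_eqI) (simp add: coeff_map_poly)
    thus ?thesis by simp
  qed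
  have homs: "poly (map_poly of_int (smult k g)) x = of_int k * poly (map_poly of_int g) x"
    for k and g :: "int poly"
  proof -
    have "map_poly of_int (smult k g) = (smult (of_int k) (map_poly of_int g) :: complex poly)"
      by (intro poly_eqI) (simp add: coeff_map_poly)
    thus ?thesis by simp
  qed
  have "poly (map_poly of_int q1) x = 0"
    using root by (simp add: q1_def map_poly_pCons algebra_simps power2_eq_square)
  hence qx: "poly (map_poly of_int q) x = 0"
    using c0 q1_0 by (subst (asm) q1) (auto simp: homs)
  obtain s r where sr: "pseudo_divmod p q = (s, r)" by fastforce
  define k where "k = lead_coeff q ^ (Suc (degree p) - degree q)"
  have pd: "smult k p = q * s + r" "r = 0 \<or> degree r < degree q"
    using pseudo_divmod[OF q0 sr] by (simp_all add: k_def)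
  have "poly (map_poly of_int r) x = 0"
    using arg_cong[OF pd(1), of "\<lambda>f. poly (map_poly of_int f) x"] p(1) qx
    by (simp add: hom homa homs)
  hence "r = 0" using poly_nonreal_root_imp_degree_ge_2[OF _ assms(2)] pd(2) degq by auto
  hence eq: "smult k p = q * s" using pd by simp
  have lq: "lead_coeff q \<noteq> 0" using q0 by simp
  have k0: "k \<noteq> 0" using lq by (simp add: k_def)
  have "content p = 1"
  proof -
    have "content p dvd lead_coeff p" by (rule content_dvd_coeff)
    hence "content p dvd 1" using p(2) by simp
    thus ?thesis by (metis normalize_content is_unit_normalize)
  qed
  hence cs: "content s = normalize k"
    using arg_cong[OF eq, of content] cq by (simp add: content_mult)
  have "k dvd content s" by (simp add: cs)
  hence "k dvd lead_coeff s" using content_dvd_coeff dvd_trans by blast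
  then obtain j where j: "lead_coeff s = k * j" by (elim dvdE)
  have "k = lead_coeff q * lead_coeff s"
    using arg_cong[OF eq, of lead_coeff] p(2) by (simp add: lead_coeff_mult k0)
  hence "lead_coeff q * j = 1" using k0 j by simp
  hence u: "lead_coeff q dvd 1" by (metis dvd_triv_left)
  have aq: "a = content q1 * lead_coeff q"
    using arg_cong[OF q1, of lead_coeff] a by (simp add: q1_def)
  have bq: "b = content q1 * coeff q 1" and cq: "c = content q1 * coeff q 0"
    using arg_cong[OF q1, of "\<lambda>f. coeff f 1"] arg_cong[OF q1, of "\<lambda>f. coeff f 0"]
    by (simp_all add: q1_def)
  have "a dvd content q1" using aq u by (metis mult_dvd_mono dvd_refl mult.right_neutral)
  thus "a dvd b" "a dvd c" using bq cq by (metis dvd_mult2)+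
qed

text \<open>Integrality of the trace and the norm makes the ring of integers discrete: it gives the lower bound 1 for
  the absolute value of nonzero integers and the finiteness of the set of integers in a disc.\<close>

lemma algebraic_int_trace_norm:
  fixes x :: complex and t n :: real
  assumes "algebraic_int x" "t = 2 * Re x" "n = (cmod x)\<^sup>2" "t \<in> \<rat>" "n \<in> \<rat>"
  shows "t \<in> \<int> \<and> n \<in> \<int>"
proof (cases "Im x = 0")
  case True
  then obtain y where y: "x = complex_of_real y" by (metis complex_is_Real_iff Reals_cases)
  have "y = t / 2" using assms y by simp
  hence "y \<in> \<rat>" using \<open>t \<in> \<rat>\<close> by (simp only: Rats_divide Rats_number_of)
  hence "x \<in> \<rat>" unfolding y by (auto elim!: Rats_cases)
  hence "x \<in> \<int>" using rational_algebraic_int_is_int assms by blast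
  then obtain k where "x = of_int k" by (elim Ints_cases)
  thus ?thesis using assms by (auto simp: norm_power[symmetric] power2_eq_square abs_mult_self_eq simp flip: of_int_mult of_int_abs)
next
  case False
  obtain p q where t: "t = of_int p / of_int q" "q > 0"
    using \<open>t \<in> \<rat>\<close> by (metis Rats_cases' )
  obtain r s where n: "n = of_int r / of_int s" "s > 0"
    using \<open>n \<in> \<rat>\<close> by (metis Rats_cases')
  have quad: "x^2 - of_real t * x + of_real n = 0"
  proof -
    have "of_real t = x + cnj x" "of_real n = x * cnj x"
      by (simp_all add: assms complex_add_cnj complex_norm_square[symmetric])
    thus ?thesis by (simp add: algebra_simps power2_eq_square)
  qed
  have "of_int (q * s) * x^2 + of_int (- (p * s)) * x + of_int (q * r)
       = of_int (q * s) * (x^2 - of_real t * x + of_real n)"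
  proof -
    have "of_int p = of_int q * t" "of_int r = of_int s * n" using t n by simp_all
    from this[THEN arg_cong[of _ _ complex_of_real]]
    have e: "of_int p = of_int q * complex_of_real t" "of_int r = of_int s * complex_of_real n"
      by simp_all
    show ?thesis unfolding of_int_mult of_int_minus e by (simp add: algebra_simps)
  qed
  hence root: "of_int (q * s) * x^2 + of_int (- (p * s)) * x + of_int (q * r) = 0"
    using quad by simp
  have dv: "q * s dvd -(p * s)" "q * s dvd q * r"
    using algebraic_int_nonreal_quadratic[OF assms(1) False _ root] t n by auto
  obtain e where "p * s = q * s * e" using dv(1)[unfolded dvd_minus_iff] by (rule dvdE)
  hence "t = of_int e" using t n by (simp add: field_simps)
  moreover obtain f where "q * r = q * s * f" using dv(2) by (rule dvdE)
  hence "n = of_int f" using t n by (simp add: field_simps)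
  ultimately show ?thesis by simp
qed

text \<open>The element \<open>\<omega>\<close>: as \<open>d\<close> is congruent to 3 modulo 4, the ring of integers is \<open>\<int> + \<int>\<omega>\<close>.\<close>

definition om :: "nat \<Rightarrow> complex" where
  "om d = (1 + \<i> * of_real (sqrt (real d))) / 2"

lemma Re_om [simp]: "Re (om d) = 1 / 2" and Im_om [simp]: "Im (om d) = sqrt (real d) / 2"
  by (simp_all add: om_def)

lemma om_square:
  assumes "d \<in> {3, 7, 11}"
  shows "(om d)\<^sup>2 = om d - of_int ((int d + 1) div 4)"
  using assms by (auto simp: complex_eq_iff power2_eq_square)

lemma ring_of_ints_trace_norm:
  assumes "x \<in> ring_of_ints d"
  shows "2 * Re x \<in> \<int>" "(cmod x)\<^sup>2 \<in> \<int>"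
proof -
  obtain a b where x: "x = a + b * (\<i> * of_real (sqrt (real d)))" "a \<in> \<rat>" "b \<in> \<rat>"
    and alg: "algebraic_int x"
    using assms by (auto simp: ring_of_ints_def imag_quadratic_field_def)
  obtain a' b' where ab: "a = of_rat a'" "b = of_rat b'" using x by (auto elim!: Rats_cases)
  have r: "(of_rat y :: complex) = of_real (of_rat y)" for y
    by (cases y) (simp add: of_rat_rat)
  have "Re x = of_rat a'" "Im x = of_rat b' * sqrt (real d)"
    by (simp_all add: x(1) ab r)
  hence "2 * Re x = of_rat (2 * a')" "(cmod x)\<^sup>2 = of_rat (a'\<^sup>2 + of_nat d * b'\<^sup>2)"
    by (simp_all add: cmod_power2 power_mult_distrib of_rat_mult of_rat_add of_rat_power)
  hence "2 * Re x \<in> \<rat>" "(cmod x)\<^sup>2 \<in> \<rat>" by (metis Rats_of_rat)+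
  thus "2 * Re x \<in> \<int>" "(cmod x)\<^sup>2 \<in> \<int>"
    using algebraic_int_trace_norm[OF alg refl refl] by auto
qed

lemma norm_ring_of_ints_ge_1:
  assumes "x \<in> ring_of_ints d" "x \<noteq> 0"
  shows "cmod x \<ge> 1"
proof -
  obtain k where k: "(cmod x)\<^sup>2 = of_int k"
    using ring_of_ints_trace_norm[OF assms(1)] by (auto elim: Ints_cases)
  have "(cmod x)\<^sup>2 > 0" using assms by simp
  hence "k \<ge> 1" using k by simp
  hence "(cmod x)\<^sup>2 \<ge> 1\<^sup>2" using k by simp
  thus ?thesis by (rule power2_le_imp_le) simp
qed

lemma finite_int_abs_le: "finite {k :: int. \<bar>of_int k\<bar> \<le> (B :: real)}"
proof (rule finite_subset)
  show "{k :: int. \<bar>of_int k\<bar> \<le> B} \<subseteq> {- \<lfloor>B\<rfloor>..\<lfloor>B\<rfloor>}"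
    by (auto simp: abs_le_iff le_floor_iff minus_le_iff)
qed simp

text \<open>A bounded square \<open>z\<^sup>2\<close> has bounded integral trace \<open>t\<close> and norm \<open>n\<close>, so \<open>z\<close> is a root of one of
  finitely many polynomials \<open>X\<^sup>4 - t X\<^sup>2 + n\<close>.\<close>

lemma finite_square_in_ring_of_ints_bounded:
  "finite {z. z\<^sup>2 \<in> ring_of_ints d \<and> cmod z \<le> r}"
proof -
  define I where "I B = {k :: int. \<bar>of_int k\<bar> \<le> (B :: real)}" for B
  have fin: "finite (I B)" for B unfolding I_def by (rule finite_int_abs_le)
  have "{z. z\<^sup>2 \<in> ring_of_ints d \<and> cmod z \<le> r} \<subseteq>
        (\<Union>t \<in> I (2 * r^2). \<Union>n \<in> I (r^4). {z. poly [:of_int n, 0, - of_int t, 0, 1:] z = 0})"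
  proof (safe, goal_cases)
    case (1 z)
    from ring_of_ints_trace_norm[OF 1(1)] obtain t n
      where tn: "2 * Re (z\<^sup>2) = of_int t" "(cmod (z\<^sup>2))\<^sup>2 = of_int n"
      by (auto elim!: Ints_cases)
    have r: "cmod z ^ 2 \<le> r ^ 2" "cmod z ^ 4 \<le> r ^ 4" using 1(2) by (auto intro: power_mono)
    have "\<bar>Re (z\<^sup>2)\<bar> \<le> cmod (z\<^sup>2)" by (rule abs_Re_le_cmod)
    hence "\<bar>of_int t\<bar> \<le> 2 * r^2" using r(1) by (simp add: tn(1)[symmetric] norm_power abs_mult)
    hence tI: "t \<in> I (2 * r^2)" by (simp add: I_def)
    have "of_int n = cmod z ^ 4" by (simp add: tn(2)[symmetric] norm_power flip: power_mult)
    hence nI: "n \<in> I (r^4)" using r(2) by (simp add: I_def)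
    have "z\<^sup>2 + cnj (z\<^sup>2) = of_int t"
      by (simp only: complex_add_cnj tn of_real_of_int_eq)
    moreover have "z\<^sup>2 * cnj (z\<^sup>2) = of_int n"
      by (simp only: complex_norm_square[symmetric] tn of_real_of_int_eq flip: of_real_power)
    ultimately have "z\<^sup>2 * z\<^sup>2 - of_int t * z\<^sup>2 + of_int n = 0"
      by (metis add.commute add_diff_cancel_right' distrib_left diff_self eq_iff_diff_eq_0
          diff_diff_eq2 mult.commute)
    hence "poly [:of_int n, 0, - of_int t, 0, 1:] z = 0"
      by (simp add: algebra_simps power2_eq_square)
    with tI nI show ?case by blast
  qed
  moreover have "finite \<dots>"
    by (intro finite_UN_I fin poly_roots_finite) auto
  ultimately show ?thesis by (rule finite_subset)
qed

text \<open>\<open>d r\<close> is a rational number whose square is the integer \<open>d (d r\<^sup>2)\<close>, so it is an integer, and the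
  prime \<open>d\<close> divides it.\<close>

lemma sqrt_rational_multiple_int:
  fixes r :: rat and d :: nat
  assumes "prime d" "of_nat d * r\<^sup>2 \<in> \<int>"
  shows "r \<in> \<int>"
proof -
  obtain k where k: "of_nat d * r\<^sup>2 = of_int k" using assms(2) by (elim Ints_cases)
  define s where "s = of_nat d * r"
  have "s\<^sup>2 = of_int (int d * k)"
    using k by (simp add: s_def power2_eq_square algebra_simps)
  hence "algebraic_int s" 
    by (intro algebraic_int_monic_quadratic[of s 0 "- (int d * k)"]) simp
  moreover have "s \<in> \<rat>" using Rats_of_rat[of s, where 'a = rat] by simp
  ultimately have "s \<in> \<int>" by (rule rational_algebraic_int_is_int)
  then obtain j where j: "s = of_int j" by (elim Ints_cases)
  have "of_int (j\<^sup>2) = (of_int (int d * k) :: rat)" using \<open>s\<^sup>2 = _\<close> j by simp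
  hence jk: "j\<^sup>2 = int d * k" by (simp only: of_int_eq_iff)
  hence "int d dvd j\<^sup>2" by simp
  hence "int d dvd j" using assms(1) by (simp add: prime_dvd_power_iff)
  then obtain i where "j = int d * i" by (elim dvdE)
  hence "r = of_int i" using j assms(1) by (auto simp: s_def prime_gt_0_nat)
  thus ?thesis by simp
qed

text \<open>With \<open>m = 2 a\<close> and \<open>n = 2 b\<close>, integrality of the norm says that \<open>m\<^sup>2 + d n\<^sup>2\<close> is divisible by 4, so
  \<open>m\<close> and \<open>n\<close> have the same parity as \<open>d\<close> is odd.  Conversely \<open>d + 1\<close> is divisible by 4, which
  makes \<open>\<omega>\<close> integral.\<close>

lemma ring_of_ints_iff:
  assumes "d \<in> {3, 7, 11}"
  shows "x \<in> ring_of_ints d \<longleftrightarrow> (\<exists>m n. x = of_int m + of_int n * om d)"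
proof
  assume x: "x \<in> ring_of_ints d"
  obtain a b where ab: "x = a + b * (\<i> * of_real (sqrt (real d)))" "a \<in> \<rat>" "b \<in> \<rat>"
    using x by (auto simp: ring_of_ints_def imag_quadratic_field_def)
  obtain a' b' where a'b': "a = of_rat a'" "b = of_rat b'" using ab by (auto elim!: Rats_cases)
  have r: "(of_rat y :: complex) = of_real (of_rat y)" for y
    by (cases y) (simp add: of_rat_rat)
  have R: "Re x = of_rat a'" "Im x = of_rat b' * sqrt (real d)"
    by (simp_all add: ab a'b' r)
  obtain m N where m: "2 * Re x = of_int m" and N: "(cmod x)\<^sup>2 = of_int N"
    using ring_of_ints_trace_norm[OF x] by (auto elim!: Ints_cases)
  have "of_rat (2 * a') = (of_rat (of_int m) :: real)" using m R by (simp add: of_rat_mult)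
  hence m': "2 * a' = of_int m" by (simp only: of_rat_eq_iff)
  have "of_rat (a'\<^sup>2 + of_nat d * b'\<^sup>2) = (of_rat (of_int N) :: real)"
    using N R by (simp add: cmod_power2 power_mult_distrib of_rat_mult of_rat_add of_rat_power mult.commute)
  hence N': "a'\<^sup>2 + of_nat d * b'\<^sup>2 = of_int N" by (simp only: of_rat_eq_iff)
  have eq: "of_nat d * (2 * b')\<^sup>2 = of_int (4 * N - m\<^sup>2)"
    using N' unfolding of_int_diff of_int_mult of_int_power m'[symmetric]
    by (simp add: algebra_simps power2_eq_square)
  have pr: "prime d" using assms by auto
  have "2 * b' \<in> \<int>"
    by (rule sqrt_rational_multiple_int[OF pr]) (simp only: eq Ints_of_int)
  then obtain n where n: "2 * b' = of_int n" by (elim Ints_cases)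
  have "of_int (int d * n\<^sup>2) = (of_int (4 * N - m\<^sup>2) :: rat)" using eq n by simp
  hence dn: "int d * n\<^sup>2 = 4 * N - m\<^sup>2" by (simp only: of_int_eq_iff)
  have "even (int d * n\<^sup>2 + m\<^sup>2)" using dn by simp
  hence "even (m - n)" using assms by auto
  then obtain k where k: "m = 2 * k + n" by (metis add.commute diff_add_cancel evenE)
  have "x = of_int k + of_int n * om d"
  proof (rule complex_eqI)
    show "Re x = Re (of_int k + of_int n * om d)" using m k by (simp add: field_simps)
    have "of_rat b' = (of_int n :: real) / 2"
      using arg_cong[OF n, of "of_rat :: rat \<Rightarrow> real"] by (simp add: of_rat_mult)
    thus "Im x = Im (of_int k + of_int n * om d)" using R by simp
  qed
  thus "\<exists>m n. x = of_int m + of_int n * om d" by blast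
next
  assume "\<exists>m n. x = of_int m + of_int n * om d"
  then obtain m n where x: "x = of_int m + of_int n * om d" by blast
  define D where "D = (int d + 1) div 4"
  have "x\<^sup>2 + of_int (- (2 * m + n)) * x + of_int (m\<^sup>2 + m * n + D * n\<^sup>2)
        = (of_int n)\<^sup>2 * ((om d)\<^sup>2 - om d + of_int D)"
    unfolding x by (simp add: algebra_simps power2_eq_square)
  also have "\<dots> = 0" using om_square[OF assms] by (simp add: D_def)
  finally have "x\<^sup>2 + of_int (- (2 * m + n)) * x + of_int (m\<^sup>2 + m * n + D * n\<^sup>2) = 0" .
  hence "algebraic_int x" by (rule algebraic_int_monic_quadratic)
  moreover have "x \<in> imag_quadratic_field d"
    unfolding imag_quadratic_field_def
    by (rule CollectI, rule exI[of _ "of_int m + of_int n / 2"], rule exI[of _ "of_int n / 2"])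
       (auto simp: x om_def field_simps)
  ultimately show "x \<in> ring_of_ints d" by (simp add: ring_of_ints_def)
qed

section \<open>Two-by-two matrices\<close>

lemma mat2_nth [simp]:
  "mat2 a b c d $ 1 $ 1 = a" "mat2 a b c d $ 1 $ 2 = b"
  "mat2 a b c d $ 2 $ 1 = c" "mat2 a b c d $ 2 $ 2 = d"
  by (simp_all add: mat2_def vector_2)

lemma mat2_eq_iff:
  "A = mat2 a b c d \<longleftrightarrow> A$1$1 = a \<and> A$1$2 = b \<and> A$2$1 = c \<and> A$2$2 = d"
  by (auto simp: vec_eq_iff forall_2)

lemma mat2_inject [simp]:
  "mat2 a b c d = mat2 a' b' c' d' \<longleftrightarrow> a = a' \<and> b = b' \<and> c = c' \<and> d = d'"
  by (simp add: mat2_eq_iff)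

lemma cmat2_cases: obtains a b c d where "A = mat2 a b c d"
  using mat2_eq_iff by blast

lemma mat2_mult: "mat2 a b c d ** mat2 a' b' c' d' =
    mat2 (a * a' + b * c') (a * b' + b * d') (c * a' + d * c') (c * b' + d * d')"
  by (simp add: mat2_eq_iff matrix_matrix_mult_def sum_2)

lemma det_mat2 [simp]: "det (mat2 a b c d) = a * d - b * c"
  by (simp add: det_2)

lemma trace_mat2 [simp]: "trace (mat2 a b c d) = a + d"
  by (simp add: trace_def sum_2)

lemma uminus_mat2 [simp]: "- mat2 a b c d = mat2 (-a) (-b) (-c) (-d)"
  by (simp add: mat2_eq_iff)

lemma mat_eq_mat2: "mat k = mat2 k 0 0 k"
  by (simp add: mat2_eq_iff mat_def)

lemma matrix_inv_mat2:
  assumes "a * d - b * c = 1"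
  shows "matrix_inv (mat2 a b c d) = mat2 d (-b) (-c) a"
proof -
  have e: "mat2 d (-b) (-c) a ** mat2 a b c d = mat 1" using assms
    by (simp add: mat2_mult mat_eq_mat2 algebra_simps)
  have i: "invertible (mat2 a b c d)" using assms by (simp add: invertible_det_nz)
  have "mat2 d (-b) (-c) a ** mat2 a b c d ** matrix_inv (mat2 a b c d) = mat2 d (-b) (-c) a ** mat 1"
    unfolding matrix_mul_assoc[symmetric] matrix_inv_cmat2(2)[OF i] ..
  thus ?thesis by (simp add: e)
qed

lemma psl_one: "\<one>\<^bsub>PSL2C\<^esub> = psl (mat 1)"
  by (simp add: PSL2C_def FactGroup_def psl_eq)

lemma inv_psl:
  assumes "det A = 1"
  shows "inv\<^bsub>PSL2C\<^esub> psl A = psl (matrix_inv A)" "det (matrix_inv A) = 1"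
proof -
  have i: "invertible A" using assms by (simp add: invertible_det_nz)
  show d: "det (matrix_inv A) = 1"
    using arg_cong[OF matrix_inv_cmat2(1)[OF i], of det] assms by (simp add: det_mul)
  interpret group PSL2C by (rule group_PSL2C)
  show "inv\<^bsub>PSL2C\<^esub> psl A = psl (matrix_inv A)"
    by (rule inv_equality) (use assms d i in \<open>auto simp: psl_mult matrix_inv_cmat2 psl_one carrier_PSL2C\<close>)
qed

lemma psl_eq_iff: "psl A = psl B \<longleftrightarrow> A = B \<or> A = - B"
  by (auto simp: psl_eq doubleton_eq_iff)

lemma psl_uminus: "psl (- A) = psl A"
  by (auto simp: psl_eq)

text \<open>Subgroups of \<open>PSL2C\<close> are handled through predicates on matrix representatives; together with
  \<open>generate_psl_induct\<close> this transfers every induction over a generated group to matrices.\<close>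

lemma subgroup_psl_image:
  assumes "P (mat 1)"
    and "\<And>A B. det A = 1 \<Longrightarrow> det B = 1 \<Longrightarrow> P A \<Longrightarrow> P B \<Longrightarrow> P (A ** B)"
    and "\<And>A. det A = 1 \<Longrightarrow> P A \<Longrightarrow> P (matrix_inv A)"
  shows "subgroup (psl ` {A. det A = 1 \<and> P A}) PSL2C"
proof -
  interpret group PSL2C by (rule group_PSL2C)
  show ?thesis
  proof (rule subgroupI)
    show "psl ` {A. det A = 1 \<and> P A} \<subseteq> carrier PSL2C" by (auto simp: carrier_PSL2C)
    have "psl (mat 1) \<in> psl ` {A. det A = 1 \<and> P A}" using assms(1) by auto
    thus "psl ` {A. det A = 1 \<and> P A} \<noteq> {}" by blast
  qed (auto simp: inv_psl psl_mult det_mul assms)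
qed

lemma psl_image_iff:
  assumes "\<And>A. P A \<Longrightarrow> P (- A)" "det A = 1"
  shows "psl A \<in> psl ` {A. det A = 1 \<and> P A} \<longleftrightarrow> P A"
  using assms by (auto simp: psl_eq_iff image_iff)

lemma generate_psl_induct:
  assumes A: "psl A \<in> generate PSL2C {psl X, psl Y}" "det A = 1" and XY: "det X = 1" "det Y = 1"
    and P: "P (mat 1)" "P X" "P Y"
    and neg: "\<And>A. P A \<Longrightarrow> P (- A)"
    and mul: "\<And>A B. det A = 1 \<Longrightarrow> det B = 1 \<Longrightarrow> P A \<Longrightarrow> P B \<Longrightarrow> P (A ** B)"
    and inv: "\<And>A. det A = 1 \<Longrightarrow> P A \<Longrightarrow> P (matrix_inv A)"
  shows "P A"
proof -
  interpret group PSL2C by (rule group_PSL2C)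
  have "generate PSL2C {psl X, psl Y} \<subseteq> psl ` {A. det A = 1 \<and> P A}"
    using XY P by (intro generate_subgroup_incl subgroup_psl_image mul inv) auto
  thus ?thesis using A psl_image_iff[of P A] neg by blast
qed

section \<open>Discreteness\<close>

text \<open>Every ball contains finitely many such matrices.  The condition is put on the squares because the
  entries \<open>l x\<close> of a matrix in \<open>PGL2_O 3\<close>, with \<open>l\<^sup>4 = 1\<close> and \<open>x \<in> O\<close>, need not lie in \<open>O\<close>.\<close>

lemma closed_if_entry_squares_integral:
  assumes C: "\<And>A i j. A \<in> C \<Longrightarrow> (A$i$j)\<^sup>2 \<in> ring_of_ints d"
  shows "closed (C :: cmat2 set)"
proof -
  have "finite (C \<inter> cball x e)" for x e
  proof -
    define F where "F = {z. z\<^sup>2 \<in> ring_of_ints d \<and> cmod z \<le> norm x + e}"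
    have F: "finite F" unfolding F_def by (rule finite_square_in_ring_of_ints_bounded)
    have "C \<inter> cball x e \<subseteq> (\<lambda>(a,b,c,d). mat2 a b c d) ` (F \<times> F \<times> F \<times> F)"
    proof
      fix A assume A: "A \<in> C \<inter> cball x e"
      have "A$i$j \<in> F" for i j
      proof -
        have "cmod (A$i$j) \<le> norm (A$i)" by (rule Finite_Cartesian_Product.norm_nth_le)
        also have "\<dots> \<le> norm A" by (rule Finite_Cartesian_Product.norm_nth_le)
        also have "\<dots> \<le> norm x + dist x A" by (metis dist_norm norm_triangle_sub norm_minus_commute add.commute)
        finally show ?thesis using A C by (auto simp: F_def)
      qed
      moreover have "A = mat2 (A$1$1) (A$1$2) (A$2$1) (A$2$2)" by (simp add: mat2_eq_iff)
      ultimately show "A \<in> (\<lambda>(a,b,c,d). mat2 a b c d) ` (F \<times> F \<times> F \<times> F)"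
        by (intro image_eqI[of _ _ "(A$1$1, A$1$2, A$2$1, A$2$2)"]) auto
    qed
    thus ?thesis using F by (meson finite_SigmaI finite_imageI finite_subset)
  qed
  hence "\<not> x islimpt C" for x
    unfolding islimpt_eq_infinite_cball by (metis zero_less_one)
  thus ?thesis by (simp add: closed_limpt)
qed

text \<open>Every subset of \<open>G\<close> has a closed preimage in the space of matrices, so the complement of \<open>G - U\<close>
  is an open set that meets \<open>G\<close> in \<open>U\<close>.\<close>

lemma kleinian_if_entry_squares_integral:
  assumes G: "subgroup G PSL2C"
    and C: "\<And>A i j. det A = 1 \<Longrightarrow> psl A \<in> G \<Longrightarrow> (A$i$j)\<^sup>2 \<in> ring_of_ints d"
  shows "kleinian_group G"
  unfolding kleinian_group_def
proof (intro conjI G)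
  have sub: "G \<subseteq> carrier PSL2C" using G by (rule subgroup.subset)
  show "subtopology PSL2C_topology G = discrete_topology G"
  proof (rule topology_eq[THEN iffD2], intro allI)
    fix U
    show "openin (subtopology PSL2C_topology G) U \<longleftrightarrow> openin (discrete_topology G) U"
    proof
      assume "openin (discrete_topology G) U"
      hence U: "U \<subseteq> G" by simp
      define V where "V = carrier PSL2C - (G - U)"
      have cl: "closed {A. det A = 1 \<and> psl A \<in> G - U}"
        by (rule closed_if_entry_squares_integral[where d = d]) (use C in auto)
      have "{A \<in> carrier SL2C. psl A \<in> V} = carrier SL2C \<inter> - {A. det A = 1 \<and> psl A \<in> G - U}"
        by (auto simp: V_def carrier_PSL2C)
      hence "openin (top_of_set (carrier SL2C)) {A \<in> carrier SL2C. psl A \<in> V}"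
        using cl by (simp add: openin_open_Int open_Compl)
      hence "openin PSL2C_topology V" by (simp add: openin_PSL2C_topology V_def)
      moreover have "U = V \<inter> G" using U sub by (auto simp: V_def)
      ultimately show "openin (subtopology PSL2C_topology G) U"
        by (auto simp: openin_subtopology)
    qed (auto simp: openin_subtopology)
  qed
qed

section \<open>Non-elementary groups\<close>

text \<open>The translations by natural numbers move every point other than infinity through an infinite orbit,
  and infinity is equivalent to all natural numbers.\<close>

lemma not_elementary_if_modular:
  assumes G: "\<And>a b c d. det (mat2 a b c d) = 1 \<Longrightarrow> a \<in> \<int> \<Longrightarrow> b \<in> \<int> \<Longrightarrow> c \<in> \<int> \<Longrightarrow> d \<in> \<int> \<Longrightarrow>
              psl (mat2 a b c d) \<in> G"
  shows "\<not> elementary_group G"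
proof
  have inf: "infinite S" if "inj f" "range f \<subseteq> S" for f :: "nat \<Rightarrow> 'z" and S
    using that by (metis infinite_UNIV_nat finite_imageD finite_subset)
  assume "elementary_group G"
  then consider p where "finite {moebius_sphere A p | A. A \<in> carrier SL2C \<and> psl A \<in> G}"
    | z t where "t > 0" "finite {moebius_space A (z, t) | A. A \<in> carrier SL2C \<and> psl A \<in> G}"
    unfolding elementary_group_def by blast
  thus False
  proof cases
    case (1 p)
    show False
    proof (cases p)
      case None
      have "range (\<lambda>n::nat. Some (of_nat n)) \<subseteq>
            {moebius_sphere A p | A. A \<in> carrier SL2C \<and> psl A \<in> G}"
      proof safe
        fix n :: nat
        have "moebius_sphere (mat2 (of_nat n) (-1) 1 0) p = Some (of_nat n)"
          by (simp add: moebius_sphere_def None)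
        moreover have "psl (mat2 (of_nat n) (-1) 1 0) \<in> G" by (rule G) auto
        ultimately show "\<exists>A. Some (of_nat n) = moebius_sphere A p \<and> A \<in> carrier SL2C \<and> psl A \<in> G"
          by (intro exI[of _ "mat2 (of_nat n) (-1) 1 0"]) simp
      qed
      from inf[OF _ this] 1 show False by (simp add: inj_def)
    next
      case (Some z)
      have "range (\<lambda>n::nat. Some (z + of_nat n)) \<subseteq>
            {moebius_sphere A p | A. A \<in> carrier SL2C \<and> psl A \<in> G}"
      proof safe
        fix n :: nat
        have "moebius_sphere (mat2 1 (of_nat n) 0 1) p = Some (z + of_nat n)"
          by (simp add: moebius_sphere_def Some)
        moreover have "psl (mat2 1 (of_nat n) 0 1) \<in> G" by (rule G) auto
        ultimately show "\<exists>A. Some (z + of_nat n) = moebius_sphere A p \<and> A \<in> carrier SL2C \<and> psl A \<in> G"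
          by (intro exI[of _ "mat2 1 (of_nat n) 0 1"]) simp
      qed
      from inf[OF _ this] 1 show False by (simp add: inj_def)
    qed
  next
    case (2 z t)
    have "range (\<lambda>n::nat. (z + of_nat n, t)) \<subseteq>
          {moebius_space A (z, t) | A. A \<in> carrier SL2C \<and> psl A \<in> G}"
    proof safe
      fix n :: nat
      have "moebius_space (mat2 1 (of_nat n) 0 1) (z, t) = (z + of_nat n, t)"
        by (simp add: moebius_space_def)
      moreover have "psl (mat2 1 (of_nat n) 0 1) \<in> G" by (rule G) auto
      ultimately show "\<exists>A. (z + of_nat n, t) = moebius_space A (z, t) \<and> A \<in> carrier SL2C \<and> psl A \<in> G"
        by (intro exI[of _ "mat2 1 (of_nat n) 0 1"]) simp
    qed
    from inf[OF _ this] 2 show False by (simp add: inj_def)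
  qed
qed

section \<open>Common invariant lines\<close>

text \<open>The vector \<open>(p, q)\<close> is an eigenvector of \<open>A\<close>; projectively, \<open>p / q\<close> is a fixed point on the sphere.\<close>

definition invariant_line :: "complex \<Rightarrow> complex \<Rightarrow> cmat2 \<Rightarrow> bool" where
  "invariant_line p q A \<longleftrightarrow>
     (\<exists>k. A$1$1 * p + A$1$2 * q = k * p \<and> A$2$1 * p + A$2$2 * q = k * q)"

lemma ex_invariant_line: "\<exists>p q. (p \<noteq> 0 \<or> q \<noteq> 0) \<and> invariant_line p q A"
proof -
  obtain e f g h where A: "A = mat2 e f g h" by (rule cmat2_cases)
  show ?thesis
  proof (cases "g = 0")
    case True
    thus ?thesis by (intro exI[of _ 1] exI[of _ 0]) (simp add: A invariant_line_def)
  next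
    case False
    define p where "p = (e - h + csqrt ((e - h)\<^sup>2 + 4 * g * f)) / (2 * g)"
    have "2 * g * p - (e - h) = csqrt ((e - h)\<^sup>2 + 4 * g * f)"
      using False by (simp add: p_def)
    hence "(2 * g * p - (e - h))\<^sup>2 = (e - h)\<^sup>2 + 4 * g * f" by simp
    hence "4 * g * (e * p + f - (g * p + h) * p) = 0"
      by (simp add: power2_eq_square algebra_simps)
    hence "e * p + f = (g * p + h) * p" using False by simp
    thus ?thesis by (intro exI[of _ p] exI[of _ 1]) (auto simp: A invariant_line_def)
  qed
qed

text \<open>Write \<open>X = s I + N\<close> with \<open>s = \<plusminus>1\<close> and \<open>N\<close> nilpotent.  Then \<open>tr [X,Y] = 2 - tr (N Y N Y\<^sup>-\<^sup>1)\<close>, and for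
  \<open>N = v w\<^sup>T\<close> the last trace is \<open>- (w\<^sup>T Y v)\<^sup>2\<close>.  If it vanishes, \<open>Y v\<close> is orthogonal to \<open>w\<close>, as is
  \<open>v\<close>, so \<open>v\<close> is a common eigenvector.\<close>

lemma common_invariant_line:
  assumes X: "det X = 1" "(trace X)\<^sup>2 = 4" and Y: "det Y = 1"
    and tr: "trace (X ** Y ** matrix_inv X ** matrix_inv Y) = 2"
  shows "\<exists>p q. (p \<noteq> 0 \<or> q \<noteq> 0) \<and> invariant_line p q X \<and> invariant_line p q Y"
proof -
  obtain a b c d where X': "X = mat2 a b c d" by (rule cmat2_cases)
  obtain e f g h where Y': "Y = mat2 e f g h" by (rule cmat2_cases)
  define s where "s = (a + d) / 2"
  define m where "m = a - s"
  have am: "a = s + m" "d = s - m" by (simp_all add: m_def s_def field_simps)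
  have s2: "s * s = 1" using X(2) by (simp add: X' s_def power2_eq_square)
  have dX: "a * d - b * c = 1" and dY: "e * h - f * g = 1" using X Y by (simp_all add: X' Y')
  have mm: "m * m + b * c = 0" using dX s2 unfolding am by (simp add: algebra_simps)
  define P where "P = (m * e + b * g) * (m * h - b * g) + (m * f + b * h) * (c * h + m * g)
      + (c * e - m * g) * (b * e - m * f) + (c * f - m * h) * (- c * f - m * e)"
  have "trace (X ** Y ** matrix_inv X ** matrix_inv Y) = 2 * (s * s) * (e * h - f * g) - P"
    unfolding X' Y' am matrix_inv_mat2[OF dX[unfolded am]] matrix_inv_mat2[OF dY] mat2_mult
      trace_mat2 P_def
    by (simp add: algebra_simps)
  hence P: "P = 0" using tr s2 dY by simp
  show ?thesis
  proof (cases "c = 0")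
    case False
    \<comment> \<open>here \<open>v = (m, c)\<close>, and \<open>w\<close> is \<open>w\<^sup>T Y v\<close> up to sign\<close>
    define w where "w = (e * m + f * c) * c - (g * m + h * c) * m"
    have "c * c * P = - (w * w)"
      using mm unfolding w_def P_def by algebra
    hence "w = 0" using P by simp
    hence w: "(e * m + f * c) * c = (g * m + h * c) * m" by (simp add: w_def)
    have "invariant_line m c X"
      unfolding invariant_line_def X' am using mm by (intro exI[of _ s]) (simp add: algebra_simps)
    moreover have "invariant_line m c Y"
      unfolding invariant_line_def Y' using w False
      by (intro exI[of _ "(g * m + h * c) / c"]) (simp add: field_simps)
    ultimately show ?thesis using False by blast
  next
    case c: True
    hence m: "m = 0" using mm by simp
    show ?thesis
    proof (cases "b = 0")
      case True
      obtain p q where "p \<noteq> 0 \<or> q \<noteq> 0" "invariant_line p q Y" using ex_invariant_line by blast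
      moreover have "invariant_line p q X"
        by (auto simp: invariant_line_def X' am m c True)
      ultimately show ?thesis by blast
    next
      case False
      have "g = 0" using P[unfolded P_def] False c m by (simp add: algebra_simps)
      thus ?thesis by (intro exI[of _ 1] exI[of _ 0]) (simp add: X' Y' invariant_line_def c)
    qed
  qed
qed

section \<open>Scaled integral matrices and the lower bound for J\<close>

definition subring_of_complex :: "complex set \<Rightarrow> bool" where
  "subring_of_complex R \<longleftrightarrow>
     1 \<in> R \<and> (\<forall>x\<in>R. \<forall>y\<in>R. x + y \<in> R \<and> x * y \<in> R \<and> - x \<in> R)"

text \<open>The factor \<open>l\<close>, always a fourth root of unity below, accounts for elements of \<open>PGL2_O 3\<close>, whose
  determinant is normalised to 1 by a square root of a unit.\<close>

definition scaled_over :: "complex \<Rightarrow> complex set \<Rightarrow> cmat2 \<Rightarrow> bool" where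
  "scaled_over l R A \<longleftrightarrow> (\<exists>a b c d. {a, b, c, d} \<subseteq> R \<and> A = mat2 (l * a) (l * b) (l * c) (l * d))"

lemma subring_of_complexD:
  assumes "subring_of_complex R"
  shows "1 \<in> R" "0 \<in> R" "x \<in> R \<Longrightarrow> - x \<in> R" "x \<in> R \<Longrightarrow> y \<in> R \<Longrightarrow> x + y \<in> R"
    "x \<in> R \<Longrightarrow> y \<in> R \<Longrightarrow> x * y \<in> R" "x \<in> R \<Longrightarrow> y \<in> R \<Longrightarrow> x - y \<in> R"
    "x \<in> R \<Longrightarrow> x ^ n \<in> R" "of_nat n \<in> R" "of_int k \<in> R" "numeral m \<in> R"
proof -
  note R = assms[unfolded subring_of_complex_def]
  show one: "1 \<in> R" and neg: "x \<in> R \<Longrightarrow> - x \<in> R"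
    and add: "x \<in> R \<Longrightarrow> y \<in> R \<Longrightarrow> x + y \<in> R" and "x \<in> R \<Longrightarrow> y \<in> R \<Longrightarrow> x * y \<in> R" for x y
    using R by blast+
  show zero: "0 \<in> R" using R by (metis add.right_inverse)
  show "x \<in> R \<Longrightarrow> y \<in> R \<Longrightarrow> x - y \<in> R" using R by (metis diff_conv_add_uminus)
  show "x \<in> R \<Longrightarrow> x ^ n \<in> R" using R by (induction n) auto
  show nat: "of_nat n \<in> R" for n using R zero by (induction n) auto
  show "of_int k \<in> R" by (cases k rule: int_cases2) (use nat R in \<open>auto simp del: of_nat_Suc\<close>)
  show "numeral m \<in> R" using nat[of "numeral m"] by simp
qed

lemma scaled_over_mat_1: "subring_of_complex R \<Longrightarrow> scaled_over 1 R (mat 1)"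
  unfolding scaled_over_def mat_eq_mat2
  by (rule exI[of _ 1], rule exI[of _ 0], rule exI[of _ 0], rule exI[of _ 1])
     (simp add: subring_of_complexD)

lemma scaled_over_uminus:
  assumes R: "subring_of_complex R" and A: "scaled_over l R A"
  shows "scaled_over l R (- A)"
proof -
  obtain a b c d where "{a, b, c, d} \<subseteq> R" "A = mat2 (l * a) (l * b) (l * c) (l * d)"
    using A by (auto simp: scaled_over_def)
  thus ?thesis unfolding scaled_over_def
    by (intro exI[of _ "- a"] exI[of _ "- b"] exI[of _ "- c"] exI[of _ "- d"])
       (auto simp: subring_of_complexD[OF R])
qed

lemma scaled_over_mult:
  assumes R: "subring_of_complex R" and A: "scaled_over l R A" and B: "scaled_over m R B"
  shows "scaled_over (l * m) R (A ** B)"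
proof -
  obtain a b c d where a: "{a, b, c, d} \<subseteq> R" "A = mat2 (l * a) (l * b) (l * c) (l * d)"
    using A by (auto simp: scaled_over_def)
  obtain e f g h where b: "{e, f, g, h} \<subseteq> R" "B = mat2 (m * e) (m * f) (m * g) (m * h)"
    using B by (auto simp: scaled_over_def)
  show ?thesis unfolding scaled_over_def
    using a b
    by (intro exI[of _ "a * e + b * g"] exI[of _ "a * f + b * h"]
              exI[of _ "c * e + d * g"] exI[of _ "c * f + d * h"])
       (auto simp: mat2_mult algebra_simps intro!: subring_of_complexD[OF R])
qed

lemma scaled_over_matrix_inv:
  assumes R: "subring_of_complex R" and A: "scaled_over l R A" "det A = 1"
  shows "scaled_over l R (matrix_inv A)"
proof -
  obtain a b c d where a: "{a, b, c, d} \<subseteq> R" "A = mat2 (l * a) (l * b) (l * c) (l * d)"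
    using A by (auto simp: scaled_over_def)
  have "matrix_inv A = mat2 (l * d) (l * (- b)) (l * (- c)) (l * a)"
    using A(2) unfolding a by (subst matrix_inv_mat2) auto
  moreover have "{d, - b, - c, a} \<subseteq> R" using a by (auto intro: subring_of_complexD[OF R])
  ultimately show ?thesis unfolding scaled_over_def by blast
qed

lemma fourth_root_of_unity_square:
  assumes "(l :: complex) ^ 4 = 1"
  shows "l\<^sup>2 = 1 \<or> l\<^sup>2 = - 1"
proof -
  have "(l\<^sup>2)\<^sup>2 = 1" using assms by (simp flip: power_mult)
  thus ?thesis using power2_eq_1_iff[of "l\<^sup>2"] by blast
qed

lemma trace_in_ring_if_scaled_square:
  assumes R: "subring_of_complex R" and A: "scaled_over l R A" and l: "l = 1 \<or> l = - 1"
  shows "trace A \<in> R"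
proof -
  obtain a b c d where "{a, b, c, d} \<subseteq> R" "A = mat2 (l * a) (l * b) (l * c) (l * d)"
    using A by (auto simp: scaled_over_def)
  thus ?thesis using l by (auto intro!: subring_of_complexD[OF R])
qed

lemma subring_ring_of_ints:
  assumes "d \<in> {3, 7, 11}"
  shows "subring_of_complex (ring_of_ints d)"
  unfolding subring_of_complex_def
proof (intro conjI ballI)
  show "1 \<in> ring_of_ints d"
    unfolding ring_of_ints_iff[OF assms] by (rule exI[of _ 1], rule exI[of _ 0]) simp
  fix x y assume "x \<in> ring_of_ints d" "y \<in> ring_of_ints d"
  then obtain m n m' n' where x: "x = of_int m + of_int n * om d" and y: "y = of_int m' + of_int n' * om d"
    unfolding ring_of_ints_iff[OF assms] by blast
  show "x + y \<in> ring_of_ints d"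
    unfolding ring_of_ints_iff[OF assms] x y
    by (intro exI[of _ "m + m'"] exI[of _ "n + n'"]) (simp add: algebra_simps)
  show "- x \<in> ring_of_ints d"
    unfolding ring_of_ints_iff[OF assms] x
    by (intro exI[of _ "- m"] exI[of _ "- n"]) (simp add: algebra_simps)
  define D where "D = (int d + 1) div 4"
  have "x * y = of_int m * of_int m' + (of_int m * of_int n' + of_int n * of_int m') * om d
        + of_int n * of_int n' * (om d)\<^sup>2"
    unfolding x y by (simp add: algebra_simps power2_eq_square)
  also have "\<dots> = of_int (m * m' - D * n * n') + of_int (m * n' + n * m' + n * n') * om d"
    unfolding om_square[OF assms] D_def by (simp add: algebra_simps)
  finally show "x * y \<in> ring_of_ints d"
    unfolding ring_of_ints_iff[OF assms] by blast
qed

text \<open>Both terms of \<open>J\<close> are absolute values of elements of \<open>O\<close>, hence 0 or at least 1, and they cannot both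
  vanish by \<open>common_invariant_line\<close>.  The scalars enter only through \<open>l\<^sup>2\<close> and \<open>l\<^sup>2 m\<^sup>2\<close>, which are
  signs.\<close>

lemma jorgensen_J_ge_1:
  assumes d: "d \<in> {3, 7, 11}"
    and X: "det X = 1" "scaled_over l (ring_of_ints d) X" "l ^ 4 = 1"
    and Y: "det Y = 1" "scaled_over m (ring_of_ints d) Y" "m ^ 4 = 1"
    and irr: "\<And>p q. p \<noteq> 0 \<or> q \<noteq> 0 \<Longrightarrow> invariant_line p q X \<Longrightarrow> \<not> invariant_line p q Y"
  shows "jorgensen_J X Y \<ge> 1"
proof -
  note R = subring_ring_of_ints[OF d]
  let ?O = "ring_of_ints d" and ?C = "X ** Y ** matrix_inv X ** matrix_inv Y"
  obtain a b c e where "{a, b, c, e} \<subseteq> ?O" "X = mat2 (l * a) (l * b) (l * c) (l * e)"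
    using X by (auto simp: scaled_over_def)
  hence tr: "(trace X)\<^sup>2 = l\<^sup>2 * (a + e)\<^sup>2" and "a \<in> ?O" "e \<in> ?O"
    by (auto simp: power2_eq_square algebra_simps)
  hence ae: "(a + e)\<^sup>2 \<in> ?O" by (intro subring_of_complexD[OF R])
  have "(trace X)\<^sup>2 = (a + e)\<^sup>2 \<or> (trace X)\<^sup>2 = - (a + e)\<^sup>2"
    using fourth_root_of_unity_square[OF X(3)] unfolding tr by fastforce
  hence "(trace X)\<^sup>2 \<in> ?O" using ae subring_of_complexD(3)[OF R ae] by auto
  hence t: "(trace X)\<^sup>2 - 4 \<in> ?O"
    by (rule subring_of_complexD(6)[OF R _ subring_of_complexD(10)[OF R]])
  have sc: "scaled_over (l * m * l * m) ?O ?C"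
    by (intro scaled_over_mult R X Y scaled_over_matrix_inv)
  have "l * m * l * m = l\<^sup>2 * m\<^sup>2" by (simp add: power2_eq_square)
  hence "l * m * l * m = 1 \<or> l * m * l * m = - 1"
    using fourth_root_of_unity_square[OF X(3)] fourth_root_of_unity_square[OF Y(3)] by auto
  hence c: "trace ?C - 2 \<in> ?O"
    using trace_in_ring_if_scaled_square[OF R sc] by (intro subring_of_complexD[OF R])
  have "(trace X)\<^sup>2 - 4 \<noteq> 0 \<or> trace ?C - 2 \<noteq> 0"
    using common_invariant_line[OF X(1) _ Y(1)] irr by auto
  thus ?thesis
    using norm_ring_of_ints_ge_1[OF t] norm_ring_of_ints_ge_1[OF c] unfolding jorgensen_J_def
    by (smt (verit) norm_ge_zero)
qed

lemma no_invariant_line_if_modular: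
  assumes XY: "det X = 1" "det Y = 1"
    and T: "psl (mat2 1 1 0 1) \<in> generate PSL2C {psl X, psl Y}"
    and S: "psl (mat2 0 (-1) 1 0) \<in> generate PSL2C {psl X, psl Y}"
    and pq: "p \<noteq> 0 \<or> q \<noteq> 0" and X: "invariant_line p q X"
  shows "\<not> invariant_line p q Y"
proof
  assume Y: "invariant_line p q Y"
  have gen: "invariant_line p q A" if "psl A \<in> generate PSL2C {psl X, psl Y}" "det A = 1" for A
  proof (rule generate_psl_induct[where P = "invariant_line p q", OF that XY _ X Y])
    show "invariant_line p q (mat 1)" by (auto simp: invariant_line_def mat_eq_mat2)
  next
    fix A assume "invariant_line p q A"
    then obtain k where "A$1$1 * p + A$1$2 * q = k * p" "A$2$1 * p + A$2$2 * q = k * q"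
      by (auto simp: invariant_line_def)
    thus "invariant_line p q (- A)"
      unfolding invariant_line_def by (intro exI[of _ "- k"]) (simp, algebra)
  next
    fix A B assume "invariant_line p q A" "invariant_line p q B"
    then obtain k j where kj: "A$1$1 * p + A$1$2 * q = k * p" "A$2$1 * p + A$2$2 * q = k * q"
      "B$1$1 * p + B$1$2 * q = j * p" "B$2$1 * p + B$2$2 * q = j * q"
      by (auto simp: invariant_line_def)
    show "invariant_line p q (A ** B)"
      unfolding invariant_line_def
      by (intro exI[of _ "k * j"], simp add: matrix_matrix_mult_def sum_2) (use kj in algebra)
  next
    fix A assume "det A = 1" "invariant_line p q A"
    obtain a b c d where A: "A = mat2 a b c d" by (rule cmat2_cases)
    obtain k where "a * p + b * q = k * p" "c * p + d * q = k * q"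
      using \<open>invariant_line p q A\<close> by (auto simp: invariant_line_def A)
    thus "invariant_line p q (matrix_inv A)"
      using \<open>det A = 1\<close> unfolding A
      by (subst matrix_inv_mat2)
         (auto simp: invariant_line_def algebra_simps intro!: exI[of _ "a + d - k"])
  qed
  obtain k where "p + q = k * p" "q = k * q"
    using gen[OF T] by (auto simp: invariant_line_def)
  hence q: "q = 0" by auto
  obtain j where "- q = j * p" "p = j * q"
    using gen[OF S] by (auto simp: invariant_line_def)
  thus False using pq q by auto
qed

section \<open>Generators of PSL(2,O)\<close>

abbreviation shift :: "complex \<Rightarrow> cmat2" where "shift x \<equiv> mat2 1 x 0 1"
abbreviation flip :: cmat2 where "flip \<equiv> mat2 0 (-1) 1 0"

lemma Re_of_om: "x = of_int m + of_int n * om d \<Longrightarrow> Re x = of_int m + of_int n / 2"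
  and Im_of_om: "x = of_int m + of_int n * om d \<Longrightarrow> Im x = of_int n * sqrt (real d) / 2"
  by (simp_all)

lemma ring_of_ints_of_om:
  assumes "d \<in> {3, 7, 11}"
  shows "of_int m + of_int n * om d \<in> ring_of_ints d"
  using ring_of_ints_iff[OF assms] by blast

lemma om_in_ring_of_ints: "d \<in> {3, 7, 11} \<Longrightarrow> om d \<in> ring_of_ints d"
  using ring_of_ints_of_om[of d 0 1] by simp

text \<open>Rounding first the imaginary and then the real coordinate leaves an error of squared absolute value at
  most \<open>1/4 + d/16\<close>, which is less than 1 for \<open>d < 12\<close>.\<close>

lemma ring_of_ints_euclidean:
  assumes d: "d \<in> {3, 7, 11}"
  shows "\<exists>q \<in> ring_of_ints d. cmod (z - q) < 1"
proof -
  define n where "n = round (2 * Im z / sqrt (real d))"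
  define m where "m = round (Re z - of_int n / 2)"
  define q where "q = of_int m + of_int n * om d"
  have "\<bar>of_int n - 2 * Im z / sqrt (real d)\<bar> \<le> 1 / 2"
    unfolding n_def by (rule of_int_round_abs_le)
  moreover have "Im (z - q) = (2 * Im z / sqrt (real d) - of_int n) * (sqrt (real d) / 2)"
    using d by (auto simp: q_def field_simps)
  hence "\<bar>Im (z - q)\<bar> = \<bar>of_int n - 2 * Im z / sqrt (real d)\<bar> * (sqrt (real d) / 2)"
    by (simp only: abs_mult abs_minus_commute) simp
  ultimately have "\<bar>Im (z - q)\<bar> \<le> 1 / 2 * (sqrt (real d) / 2)"
    by (simp only:) (intro mult_right_mono, auto)
  hence "(Im (z - q))\<^sup>2 \<le> (1 / 2 * (sqrt (real d) / 2))\<^sup>2"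
    by (metis abs_ge_zero power2_abs power_mono)
  also have "\<dots> = real d / 16" by (simp add: power_mult_distrib power_divide)
  finally have i: "(Im (z - q))\<^sup>2 \<le> 11 / 16" using d by auto
  have "\<bar>of_int m - (Re z - of_int n / 2)\<bar> \<le> 1 / 2"
    unfolding m_def by (rule of_int_round_abs_le)
  moreover have "Re (z - q) = - (of_int m - (Re z - of_int n / 2))" by (simp add: q_def)
  ultimately have "\<bar>Re (z - q)\<bar> \<le> 1 / 2" by (simp only: abs_minus_cancel)
  hence "(Re (z - q))\<^sup>2 \<le> (1 / 2)\<^sup>2" by (metis abs_ge_zero power2_abs power_mono)
  hence "(cmod (z - q))\<^sup>2 < 1\<^sup>2" using i by (simp add: cmod_power2 power_divide)
  hence "cmod (z - q) < 1" by (rule power2_less_imp_less) simp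
  moreover have "q \<in> ring_of_ints d" unfolding q_def by (rule ring_of_ints_of_om[OF d])
  ultimately show ?thesis by blast
qed

lemma psl_image_scaled_iff:
  assumes "subring_of_complex R" "det A = 1"
  shows "psl A \<in> psl ` {A. det A = 1 \<and> (\<exists>l\<in>L. scaled_over l R A)} \<longleftrightarrow> (\<exists>l\<in>L. scaled_over l R A)"
  using scaled_over_uminus[OF assms(1)] assms(2) by (intro psl_image_iff) blast+

lemma subgroup_psl_scaled:
  assumes R: "subring_of_complex R" and "1 \<in> L" "\<And>l m. l \<in> L \<Longrightarrow> m \<in> L \<Longrightarrow> l * m \<in> L"
  shows "subgroup (psl ` {A. det A = 1 \<and> (\<exists>l\<in>L. scaled_over l R A)}) PSL2C"
  using assms scaled_over_mat_1 scaled_over_mult scaled_over_matrix_inv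
  by (intro subgroup_psl_image) blast+

lemma SL2_O_iff: "A \<in> SL2_O d \<longleftrightarrow> det A = 1 \<and> scaled_over 1 (ring_of_ints d) A"
  by (rule cmat2_cases[of A]) (auto simp: SL2_O_def scaled_over_def forall_2)

lemma PSL2_O_eq: "PSL2_O d = psl ` {A. det A = 1 \<and> (\<exists>l\<in>{1}. scaled_over l (ring_of_ints d) A)}"
  by (auto simp: PSL2_O_def SL2_O_iff intro!: image_eqI)

context
  fixes d :: nat and H :: "cmat2 set set"
  assumes d: "d \<in> {3, 7, 11}" and H: "subgroup H PSL2C"
    and flip: "psl flip \<in> H"
    and shift_1: "psl (shift 1) \<in> H" and shift_om: "psl (shift (om d)) \<in> H"
begin

private lemma mult_in: "psl A \<in> H \<Longrightarrow> psl B \<in> H \<Longrightarrow> det A = 1 \<Longrightarrow> det B = 1 \<Longrightarrow> psl (A ** B) \<in> H"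
  using subgroup.m_closed[OF H] by (metis psl_mult carrier_SL2C)

private lemma inv_in: "psl A \<in> H \<Longrightarrow> det A = 1 \<Longrightarrow> psl (matrix_inv A) \<in> H"
  using subgroup.m_inv_closed[OF H] inv_psl by metis

private lemma shift_add: "psl (shift x) \<in> H \<Longrightarrow> psl (shift y) \<in> H \<Longrightarrow> psl (shift (x + y)) \<in> H"
  using mult_in[of "shift x" "shift y"] by (simp add: mat2_mult add.commute)

private lemma shift_of_int_mult:
  assumes "psl (shift x) \<in> H"
  shows "psl (shift (of_int k * x)) \<in> H"
proof -
  have nat: "psl (shift (of_nat n * x)) \<in> H" for n
  proof (induction n)
    case 0
    show ?case using subgroup.one_closed[OF H] by (simp add: psl_one mat_eq_mat2)
  next
    case (Suc n)
    show ?case using shift_add[OF Suc assms] by (simp add: algebra_simps)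
  qed
  have "psl (shift (- (of_nat n * x))) \<in> H" for n
    using inv_in[OF nat, of n] by (simp add: matrix_inv_mat2)
  thus ?thesis using nat by (cases k rule: int_cases2) simp_all
qed

private lemma shift_in:
  assumes "x \<in> ring_of_ints d"
  shows "psl (shift x) \<in> H"
proof -
  obtain m n where "x = of_int m * 1 + of_int n * om d"
    using assms unfolding ring_of_ints_iff[OF d] by auto
  thus ?thesis by (simp only: shift_add shift_of_int_mult shift_1 shift_om)
qed

text \<open>Diagonal matrices are words in elementary matrices: the classical expression of \<open>diag(u, u\<^sup>-\<^sup>1)\<close> by
  \<open>shift u\<close>, \<open>shift (u\<^sup>-\<^sup>1)\<close> and \<open>flip\<close>.\<close>

private lemma diag_in:
  assumes u: "u \<in> ring_of_ints d" "v \<in> ring_of_ints d" "u * v = 1"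
  shows "psl (mat2 u 0 0 v) \<in> H"
proof -
  have "psl (shift u ** flip ** (shift v ** flip) ** (shift u ** flip)) \<in> H"
    by (intro mult_in shift_in u flip) (simp_all add: det_mul)
  moreover have "shift u ** flip ** (shift v ** flip) ** (shift u ** flip) = - mat2 u 0 0 v"
    using u(3) by (simp add: mat2_mult algebra_simps)
  ultimately show ?thesis by (simp only: psl_uminus)
qed

text \<open>The Euclidean algorithm: multiplying by a translation and by \<open>flip\<close> replaces the lower left entry
  \<open>c\<close> by a remainder modulo \<open>c\<close>.  It ends with an upper triangular matrix, which is a product of a
  diagonal matrix of units and a translation.  The integer \<open>|c|\<^sup>2\<close> is the induction variable.\<close>

lemma PSL2_O_subset_if_generators: "PSL2_O d \<subseteq> H"
proof -
  note R = subring_of_complexD[OF subring_ring_of_ints[OF d]]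
  let ?O = "ring_of_ints d"
  have zero: "psl (mat2 a b c e) \<in> H"
    if "a \<in> ?O" "b \<in> ?O" "e \<in> ?O" "a * e - b * c = 1" "c = 0" for a b c e
  proof -
    have "psl (mat2 a 0 0 e ** shift (e * b)) \<in> H"
      using that by (intro mult_in diag_in shift_in R) auto
    moreover have "mat2 a 0 0 e ** shift (e * b) = mat2 a b c e"
      using that by (simp add: mat2_mult mult.assoc[symmetric])
    ultimately show ?thesis by simp
  qed
  have main: "psl (mat2 a b c e) \<in> H"
    if "a \<in> ?O" "b \<in> ?O" "c \<in> ?O" "e \<in> ?O" "a * e - b * c = 1" "(cmod c)\<^sup>2 \<le> real n" for a b c e n
    using that
  proof (induction n arbitrary: a b c e)
    case 0
    thus ?case using zero by simp
  next
    case (Suc n)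
    show ?case
    proof (cases "c = 0")
      case True
      thus ?thesis using zero Suc.prems by blast
    next
      case False
      obtain q where q: "q \<in> ?O" "cmod (a / c - q) < 1" using ring_of_ints_euclidean[OF d] by blast
      define r where "r = a - q * c"
      have r: "r \<in> ?O" unfolding r_def by (intro R q Suc.prems)
      have "r = (a / c - q) * c" using False by (simp add: r_def field_simps)
      hence "cmod r < cmod c" using q(2) False by (simp add: norm_mult)
      hence "(cmod r)\<^sup>2 < (cmod c)\<^sup>2" by (intro power_strict_mono) auto
      also have "\<dots> \<le> real (Suc n)" by fact
      finally have "(cmod r)\<^sup>2 < real (Suc n)" .
      moreover obtain k where "(cmod r)\<^sup>2 = of_int k"
        using ring_of_ints_trace_norm(2)[OF r] by (elim Ints_cases)
      ultimately have "real_of_int k < real_of_int (1 + int n)" "(cmod (- r))\<^sup>2 = of_int k"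
        by simp_all
      hence "(cmod (- r))\<^sup>2 \<le> real n" unfolding of_int_less_iff by simp
      have "c * (q * e - b) - e * (- r) = 1"
        using Suc.prems(5) by (simp add: r_def algebra_simps)
      hence "psl (mat2 c e (- r) (q * e - b)) \<in> H"
        using r q \<open>(cmod (- r))\<^sup>2 \<le> real n\<close> by (intro Suc.IH R Suc.prems) auto
      hence "psl (shift q ** flip ** mat2 c e (- r) (q * e - b)) \<in> H"
        using \<open>c * _ - _ = 1\<close> by (intro mult_in shift_in q flip) (simp_all add: det_mul)
      moreover have "shift q ** flip ** mat2 c e (- r) (q * e - b) = mat2 a b c e"
        by (simp add: mat2_mult r_def)
      ultimately show ?thesis by simp
    qed
  qed
  have "psl (mat2 a b c e) \<in> H"
    if "a \<in> ?O" "b \<in> ?O" "c \<in> ?O" "e \<in> ?O" "a * e - b * c = 1" for a b c e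
    using main[OF that, of "nat \<lceil>(cmod c)\<^sup>2\<rceil>"] by linarith
  thus ?thesis by (auto simp: PSL2_O_def SL2_O_iff scaled_over_def)
qed

end

section \<open>Units, and PGL(2,O) for d = 3\<close>

lemma cnj_om: "cnj (om d) = 1 - om d"
  by (simp add: complex_eq_iff)

text \<open>For \<open>u = m + n \<omega>\<close> the equation \<open>4 |u|\<^sup>2 = 4\<close> reads \<open>(2 m + n)\<^sup>2 + d n\<^sup>2 = 4\<close>, so \<open>n = 0\<close>
  unless \<open>d = 3\<close>.\<close>

lemma ring_of_ints_unit_cases:
  assumes d: "d \<in> {3, 7, 11}" and u: "u \<in> ring_of_ints d" "cmod u = 1"
  shows "u = 1 \<or> u = - 1 \<or> d = 3 \<and> u \<in> {om 3, - om 3, 1 - om 3, - (1 - om 3)}"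
proof -
  obtain m n where mn: "u = of_int m + of_int n * om d"
    using u(1) unfolding ring_of_ints_iff[OF d] by blast
  have "4 * (cmod u)\<^sup>2 = of_int ((2 * m + n)\<^sup>2 + int d * n\<^sup>2)"
    unfolding cmod_power2 mn Re_of_om[OF refl] Im_of_om[OF refl]
    by (simp add: power_mult_distrib power_divide) (simp add: field_simps power2_eq_square)
  hence "real_of_int ((2 * m + n)\<^sup>2 + int d * n\<^sup>2) = real_of_int 4" using u(2) by simp
  hence e: "(2 * m + n)\<^sup>2 + int d * n\<^sup>2 = 4" by (simp only: of_int_eq_iff)
  have "int d * n\<^sup>2 \<le> 4" using e by (smt (verit) zero_le_power2)
  hence "n\<^sup>2 \<le> 1" using d by auto
  hence "\<bar>n\<bar> \<le> 1" by (simp add: abs_square_le_1)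
  hence n: "n = 0 \<or> n = 1 \<or> n = - 1" by linarith
  show ?thesis
  proof (cases "n = 0")
    case True
    hence "m = 1 \<or> m = - 1" using e by (simp add: power2_eq_1_iff power_mult_distrib)
    thus ?thesis using mn True by auto
  next
    case False
    hence n2: "n\<^sup>2 = 1" using n by auto
    hence "(2 * m + n)\<^sup>2 = 4 - int d" using e by simp
    moreover have "0 \<le> (2 * m + n)\<^sup>2" by simp
    ultimately have d3: "d = 3" and "(2 * m + n)\<^sup>2 = 1" using d by auto
    hence "2 * m + n = 1 \<or> 2 * m + n = - 1" by (simp add: power2_eq_1_iff)
    hence "(m = 0 \<and> n = 1) \<or> (m = - 1 \<and> n = 1) \<or> (m = 1 \<and> n = - 1) \<or> (m = 0 \<and> n = - 1)"
      using n False by presburger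
    thus ?thesis using mn d3 by auto
  qed
qed

lemma om_3_square: "om 3 * om 3 = om 3 - 1"
  using om_square[of 3] by (simp add: power2_eq_square)

lemma unit_sign_times_square:
  assumes "u \<in> ring_of_ints 3" "cmod u = 1"
  shows "\<exists>w\<in>ring_of_ints 3. \<exists>w'\<in>ring_of_ints 3. w * w' = 1 \<and> (u = w\<^sup>2 \<or> u = - w\<^sup>2)"
proof -
  have R0: "subring_of_complex (ring_of_ints 3)" by (rule subring_ring_of_ints) simp
  note R = subring_of_complexD[OF R0]
  have om: "om 3 \<in> ring_of_ints 3" "1 - om 3 \<in> ring_of_ints 3"
    by (auto intro!: R om_in_ring_of_ints)
  have sq: "(om 3)\<^sup>2 = - (1 - om 3)" "(1 - om 3)\<^sup>2 = - om 3"
    and pr: "om 3 * (1 - om 3) = 1" "(1 - om 3) * om 3 = 1"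
    by (simp_all add: power2_eq_square algebra_simps om_3_square)
  consider "u = 1 \<or> u = - 1" | "u = om 3 \<or> u = - om 3" | "u = 1 - om 3 \<or> u = - (1 - om 3)"
    using ring_of_ints_unit_cases[OF _ assms] by auto
  thus ?thesis
  proof cases
    case 1
    thus ?thesis by (intro bexI[of _ 1]) (auto intro!: R)
  next
    case 2
    thus ?thesis by (intro bexI[OF _ om(2)] bexI[OF _ om(1)] conjI pr) (auto simp: sq)
  next
    case 3
    thus ?thesis by (intro bexI[OF _ om(1)] bexI[OF _ om(2)] conjI pr) (auto simp: sq)
  qed
qed

text \<open>If \<open>det (l B) = 1\<close> and \<open>det B = \<plusminus> w\<^sup>2\<close>, then moving the unit \<open>w\<close> from \<open>B\<close> to the scalar leaves the
  scalar \<open>l w\<close> with \<open>(l w)\<^sup>2 = \<plusminus>1\<close>.\<close>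

lemma PGL2_O_3_eq:
  "PGL2_O 3 = psl ` {A. det A = 1 \<and> (\<exists>l\<in>{l. l ^ 4 = 1}. scaled_over l (ring_of_ints 3) A)}"
proof -
  have R0: "subring_of_complex (ring_of_ints 3)" by (rule subring_ring_of_ints) simp
  note R = subring_of_complexD[OF R0]
  let ?O = "ring_of_ints 3"
  have "(\<exists>l. \<exists>B\<in>GL2_O 3. A = mat l ** B) \<longleftrightarrow> (\<exists>l\<in>{l. l ^ 4 = 1}. scaled_over l ?O A)"
    if A: "det A = 1" for A
  proof
    assume "\<exists>l. \<exists>B\<in>GL2_O 3. A = mat l ** B"
    then obtain l B where B: "B \<in> GL2_O 3" "A = mat l ** B" by blast
    obtain a b c e where B': "B = mat2 a b c e" by (rule cmat2_cases)
    obtain v where O: "{a, b, c, e} \<subseteq> ?O" "v \<in> ?O" and uv: "(a * e - b * c) * v = 1"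
      using B(1) by (auto simp: B' GL2_O_def forall_2)
    have uO: "a * e - b * c \<in> ?O" using O by (intro R) auto
    have "cmod (a * e - b * c) * cmod v = 1" using uv by (simp flip: norm_mult)
    moreover have "a * e - b * c \<noteq> 0" "v \<noteq> 0"
      using uv by (metis mult_zero_left zero_neq_one) (use uv in auto)
    hence "cmod (a * e - b * c) \<ge> 1" "cmod v \<ge> 1"
      using norm_ring_of_ints_ge_1 uO O(2) by blast+
    ultimately have "cmod (a * e - b * c) = 1"
      by (smt (verit) mult_le_cancel_left1)
    then obtain w w' where w: "w \<in> ?O" "w' \<in> ?O" "w * w' = 1"
      and u: "a * e - b * c = w\<^sup>2 \<or> a * e - b * c = - w\<^sup>2"
      using unit_sign_times_square[OF uO] by blast
    have A': "A = mat2 (l * a) (l * b) (l * c) (l * e)"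
      by (simp add: B B' mat_eq_mat2 mat2_mult)
    have "l\<^sup>2 * (a * e - b * c) = 1" using A by (simp add: A' algebra_simps power2_eq_square)
    hence "(l * w)\<^sup>2 = 1 \<or> (l * w)\<^sup>2 = - 1"
      using u by (auto simp: power_mult_distrib minus_equation_iff)
    hence "((l * w)\<^sup>2)\<^sup>2 = 1" by (elim disjE) simp_all
    hence l4: "(l * w) ^ 4 = 1" by (simp flip: power_mult)
    have "(l * w) * (w' * x) = l * x" for x using w(3) by (metis mult.assoc mult_1)
    hence "A = mat2 ((l * w) * (w' * a)) ((l * w) * (w' * b)) ((l * w) * (w' * c)) ((l * w) * (w' * e))"
      by (simp add: A')
    moreover have "{w' * a, w' * b, w' * c, w' * e} \<subseteq> ?O" using O w by (auto intro!: R)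
    ultimately show "\<exists>l\<in>{l. l ^ 4 = 1}. scaled_over l ?O A"
      using l4 unfolding scaled_over_def by blast
  next
    assume "\<exists>l\<in>{l. l ^ 4 = 1}. scaled_over l ?O A"
    then obtain l a b c e where l: "l ^ 4 = 1" and O: "{a, b, c, e} \<subseteq> ?O"
      and A': "A = mat2 (l * a) (l * b) (l * c) (l * e)" by (auto simp: scaled_over_def)
    have "l\<^sup>2 * (a * e - b * c) = 1" using A by (simp add: A' algebra_simps power2_eq_square)
    hence "l ^ 4 * (a * e - b * c) = l\<^sup>2" by (simp add: power4_eq_xxxx power2_eq_square mult.assoc)
    hence "a * e - b * c = 1 \<or> a * e - b * c = - 1"
      using fourth_root_of_unity_square[OF l] l by simp
    hence "\<exists>u\<in>?O. (a * e - b * c) * u = 1"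
      using R(1) R(3)[OF R(1)]
      by (elim disjE) (auto intro: bexI[of _ 1] bexI[of _ "- 1"])
    hence "mat2 a b c e \<in> GL2_O 3" using O by (simp add: GL2_O_def forall_2)
    moreover have "A = mat l ** mat2 a b c e" by (simp add: A' mat_eq_mat2 mat2_mult)
    ultimately show "\<exists>l. \<exists>B\<in>GL2_O 3. A = mat l ** B" by blast
  qed
  hence "{A. A \<in> carrier SL2C \<and> (\<exists>l. \<exists>B\<in>GL2_O 3. A = mat l ** B)} =
     {A. det A = 1 \<and> (\<exists>l\<in>{l. l ^ 4 = 1}. scaled_over l ?O A)}" by auto
  moreover have "PGL2_O 3 = psl ` {A. A \<in> carrier SL2C \<and> (\<exists>l. \<exists>B\<in>GL2_O 3. A = mat l ** B)}"
    by (auto simp: PGL2_O_def)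
  ultimately show ?thesis by simp
qed

section \<open>The four groups are Jorgensen groups of parabolic type\<close>

text \<open>For \<open>X = T\<close> the trace of the commutator with a matrix of lower left entry \<open>c\<close> is \<open>2 + c\<^sup>2\<close>, so the
  given pair attains \<open>J = |c|\<^sup>2 = 1\<close>.\<close>

lemma jorgensen_parabolic_typeI:
  assumes d: "d \<in> {3, 7, 11}"
    and gen: "G = generate PSL2C {psl (shift 1), psl (mat2 a b c e)}"
    and det: "a * e - b * c = 1" and c: "cmod c = 1"
    and sub: "PSL2_O d \<subseteq> G"
    and scaled: "\<And>A. det A = 1 \<Longrightarrow> psl A \<in> G \<Longrightarrow> \<exists>l. l ^ 4 = 1 \<and> scaled_over l (ring_of_ints d) A"
  shows "jorgensen_parabolic_type G"
proof -
  note R = subring_ring_of_ints[OF d]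
  interpret group PSL2C by (rule group_PSL2C)
  let ?Y = "mat2 a b c e"
  have pair: "generating_pair G (shift 1) ?Y"
    using gen det by (simp add: generating_pair_def)
  have J: "jorgensen_J (shift 1) ?Y = 1"
  proof -
    have "trace (shift 1 ** ?Y ** matrix_inv (shift 1) ** matrix_inv ?Y)
        = 2 * (a * e - b * c) + c * c"
      using det by (simp add: matrix_inv_mat2 mat2_mult algebra_simps)
    thus ?thesis using det c by (simp add: jorgensen_J_def norm_mult)
  qed
  have int: "psl (mat2 p q r s) \<in> G"
    if "det (mat2 p q r s) = 1" "p \<in> \<int>" "q \<in> \<int>" "r \<in> \<int>" "s \<in> \<int>" for p q r s
  proof -
    have "x \<in> ring_of_ints d" if "x \<in> \<int>" for x
      using that by (elim Ints_cases) (simp add: subring_of_complexD(9)[OF R])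
    hence "scaled_over 1 (ring_of_ints d) (mat2 p q r s)"
      using that unfolding scaled_over_def by auto
    hence "psl (mat2 p q r s) \<in> PSL2_O d" using that(1) unfolding PSL2_O_eq by blast
    thus ?thesis using sub by blast
  qed
  have "subgroup G PSL2C"
    unfolding gen by (rule generate_is_subgroup) (use det in \<open>auto simp: carrier_PSL2C\<close>)
  moreover have "(A$i$j)\<^sup>2 \<in> ring_of_ints d" if A: "det A = 1" "psl A \<in> G" for A i j
  proof -
    obtain l p q r s where l: "l ^ 4 = 1" and O: "{p, q, r, s} \<subseteq> ring_of_ints d"
      and A': "A = mat2 (l * p) (l * q) (l * r) (l * s)"
      using scaled[OF A] by (auto simp: scaled_over_def)
    have sq: "(l * x)\<^sup>2 \<in> ring_of_ints d" if "x \<in> ring_of_ints d" for x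
      using fourth_root_of_unity_square[OF l] subring_of_complexD(7)[OF R that, of 2]
        subring_of_complexD(3)[OF R subring_of_complexD(7)[OF R that, of 2]]
      by (auto simp: power_mult_distrib)
    show ?thesis
      using exhaust_2[of i] exhaust_2[of j] O sq unfolding A' by (elim disjE) auto
  qed
  ultimately have kl: "kleinian_group G" by (rule kleinian_if_entry_squares_integral)
  have ge: "jorgensen_J X Y \<ge> 1" if "generating_pair G X Y" for X Y
  proof -
    have XY: "det X = 1" "det Y = 1" and G: "G = generate PSL2C {psl X, psl Y}"
      using that by (auto simp: generating_pair_def)
    have "psl X \<in> G" "psl Y \<in> G" unfolding G by (auto intro: generate.incl)
    then obtain l m where "l ^ 4 = 1" "scaled_over l (ring_of_ints d) X"
      "m ^ 4 = 1" "scaled_over m (ring_of_ints d) Y" using scaled XY by meson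
    moreover have "psl (shift 1) \<in> G" "psl flip \<in> G" by (auto intro!: int)
    ultimately show ?thesis
      using no_invariant_line_if_modular[OF XY] XY unfolding G by (intro jorgensen_J_ge_1[OF d])
  qed
  have "jorgensen_number G = 1"
    unfolding jorgensen_number_def
    by (rule cInf_eq_minimum) (use pair J ge in force)+
  moreover have "parabolic (shift 1)"
    by (auto simp: parabolic_def mat_eq_mat2)
  moreover have "\<not> elementary_group G" using int by (rule not_elementary_if_modular)
  ultimately show ?thesis
    unfolding jorgensen_parabolic_type_def jorgensen_group_def using kl pair J by blast
qed

text \<open>The second generator is \<open>Y = U S\<close> with \<open>U = shift \<omega>\<close> and \<open>S = flip\<close>.  As \<open>U\<close> commutes with \<open>T\<close>,
  the word \<open>T Y\<^sup>-\<^sup>1 T Y T\<close> equals \<open>T S\<^sup>-\<^sup>1 T S T\<close>, which is \<open>S\<close> up to sign.\<close>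

lemma PSL2_O_generated:
  assumes d: "d \<in> {3, 7, 11}"
  shows "generate PSL2C {psl (shift 1), psl (mat2 (om d) (-1) 1 0)} = PSL2_O d" (is "?H = _")
proof
  interpret group PSL2C by (rule group_PSL2C)
  note R = subring_of_complexD[OF subring_ring_of_ints[OF d]]
  have "psl (shift 1) \<in> PSL2_O d" "psl (mat2 (om d) (-1) 1 0) \<in> PSL2_O d"
    unfolding PSL2_O_eq psl_image_scaled_iff[OF subring_ring_of_ints[OF d]]
    by (auto simp: psl_image_scaled_iff[OF subring_ring_of_ints[OF d]] scaled_over_def
        intro!: R om_in_ring_of_ints d)
  moreover have "subgroup (PSL2_O d) PSL2C"
    unfolding PSL2_O_eq by (rule subgroup_psl_scaled[OF subring_ring_of_ints[OF d]]) auto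
  ultimately show "?H \<subseteq> PSL2_O d" by (intro generate_subgroup_incl) auto
  have H: "subgroup ?H PSL2C"
    by (rule generate_is_subgroup) (auto simp: carrier_PSL2C)
  have mult: "psl (A ** B) \<in> ?H" if "psl A \<in> ?H" "psl B \<in> ?H" "det A = 1" "det B = 1" for A B
    using subgroup.m_closed[OF H that(1,2)] that by (simp add: psl_mult)
  have inv: "psl (matrix_inv A) \<in> ?H" if "psl A \<in> ?H" "det A = 1" for A
    using subgroup.m_inv_closed[OF H that(1)] that by (simp add: inv_psl)
  have T: "psl (shift 1) \<in> ?H" and Y: "psl (mat2 (om d) (-1) 1 0) \<in> ?H"
    by (auto intro: generate.incl)
  have y: "psl (mat2 0 1 (-1) (om d)) \<in> ?H" using inv[OF Y] by (simp add: matrix_inv_mat2)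
  have "psl (shift 1 ** mat2 0 1 (-1) (om d) ** shift 1 ** mat2 (om d) (-1) 1 0 ** shift 1) \<in> ?H"
    by (intro mult T Y y) (simp_all add: det_mul)
  moreover have "shift 1 ** mat2 0 1 (-1) (om d) ** shift 1 ** mat2 (om d) (-1) 1 0 ** shift 1 = - flip"
    by (simp add: mat2_mult algebra_simps)
  ultimately have S: "psl flip \<in> ?H" by (simp only: psl_uminus)
  have "psl (mat2 (om d) (-1) 1 0 ** flip) \<in> ?H" by (intro mult Y S) simp_all
  moreover have "mat2 (om d) (-1) 1 0 ** flip = - shift (om d)" by (simp add: mat2_mult)
  ultimately have U: "psl (shift (om d)) \<in> ?H" by (simp only: psl_uminus)
  show "PSL2_O d \<subseteq> ?H" by (rule PSL2_O_subset_if_generators[OF d H S T U])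
qed

text \<open>Again \<open>S\<close> is a short word in \<open>T\<close> and \<open>Y = i (\<omega>, 1; 1, 0)\<close>.  The word \<open>D = Y\<^sup>-\<^sup>2 T Y\<^sup>-\<^sup>1\<close> is diagonal
  and conjugates \<open>T\<close> to \<open>shift \<omega>\<close>, so the group contains \<open>PSL2_O 3\<close>; every other element becomes an
  element of \<open>PSL2_O 3\<close> after multiplication by \<open>Y\<^sup>-\<^sup>1\<close>, which has scalar \<open>i\<close>.\<close>

lemma PGL2_O_3_generated:
  "generate PSL2C {psl (shift 1), psl (mat2 (\<i> * om 3) \<i> \<i> 0)} = PGL2_O 3" (is "?H = _")
  and PSL2_O_3_subset_PGL2_O_3: "PSL2_O 3 \<subseteq> PGL2_O 3"
proof -
  interpret group PSL2C by (rule group_PSL2C)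
  have R0: "subring_of_complex (ring_of_ints 3)" by (rule subring_ring_of_ints) simp
  note R = subring_of_complexD[OF R0]
  have om: "om 3 \<in> ring_of_ints 3" by (rule om_in_ring_of_ints) simp
  show "PSL2_O 3 \<subseteq> PGL2_O 3"
    unfolding PSL2_O_eq PGL2_O_3_eq by (rule image_mono) (auto intro: exI[of _ 1])
  have scY: "scaled_over \<i> (ring_of_ints 3) (mat2 (\<i> * om 3) \<i> \<i> 0)"
    unfolding scaled_over_def
    by (rule exI[of _ "om 3"], rule exI[of _ 1], rule exI[of _ 1], rule exI[of _ 0])
       (auto intro: R om)
  have scT: "scaled_over 1 (ring_of_ints 3) (shift 1)"
    unfolding scaled_over_def by (auto intro!: R)
  have mem: "psl A \<in> PGL2_O 3"
    if "det A = 1" "l ^ 4 = 1" "scaled_over l (ring_of_ints 3) A" for l A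
    using that unfolding PGL2_O_3_eq by blast
  have "psl (shift 1) \<in> PGL2_O 3" "psl (mat2 (\<i> * om 3) \<i> \<i> 0) \<in> PGL2_O 3"
    by (rule mem[OF _ _ scT], simp, simp) (rule mem[OF _ _ scY], simp, simp)
  moreover have "subgroup (PGL2_O 3) PSL2C"
    unfolding PGL2_O_3_eq by (rule subgroup_psl_scaled[OF R0]) (auto simp: power_mult_distrib)
  ultimately have "?H \<subseteq> PGL2_O 3" by (intro generate_subgroup_incl) auto
  have H: "subgroup ?H PSL2C"
    by (rule generate_is_subgroup) (auto simp: carrier_PSL2C)
  have mult: "psl (A ** B) \<in> ?H" if "psl A \<in> ?H" "psl B \<in> ?H" "det A = 1" "det B = 1" for A B
    using subgroup.m_closed[OF H that(1,2)] that by (simp add: psl_mult)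
  have inv: "psl (matrix_inv A) \<in> ?H" if "psl A \<in> ?H" "det A = 1" for A
    using subgroup.m_inv_closed[OF H that(1)] that by (simp add: inv_psl)
  have T: "psl (shift 1) \<in> ?H" and Y: "psl (mat2 (\<i> * om 3) \<i> \<i> 0) \<in> ?H"
    by (auto intro: generate.incl)
  have t: "psl (shift (- 1)) \<in> ?H" using inv[OF T] by (simp add: matrix_inv_mat2)
  have y: "psl (mat2 0 (-\<i>) (-\<i>) (\<i> * om 3)) \<in> ?H" using inv[OF Y] by (simp add: matrix_inv_mat2)
  have "psl (shift 1 ** mat2 0 (-\<i>) (-\<i>) (\<i> * om 3) ** shift (- 1) ** mat2 (\<i> * om 3) \<i> \<i> 0 ** shift 1) \<in> ?H"
    by (intro mult T Y y t) (simp_all add: det_mul)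
  moreover have "shift 1 ** mat2 0 (-\<i>) (-\<i>) (\<i> * om 3) ** shift (- 1) ** mat2 (\<i> * om 3) \<i> \<i> 0 ** shift 1 = - flip"
    by (simp add: mat2_mult algebra_simps)
  ultimately have S: "psl flip \<in> ?H" by (simp only: psl_uminus)
  define D where "D = mat2 0 (-\<i>) (-\<i>) (\<i> * om 3) ** mat2 0 (-\<i>) (-\<i>) (\<i> * om 3) ** shift 1
      ** mat2 0 (-\<i>) (-\<i>) (\<i> * om 3)"
  have D_in: "psl D \<in> ?H" unfolding D_def by (intro mult T y) (simp_all add: det_mul)
  have "om 3 * (om 3 * x) = om 3 * x - x" for x
    by (metis om_3_square left_diff_distrib mult.assoc mult_1)
  note om2 = om_3_square this
  have D: "D = mat2 (\<i> * (1 - om 3)) 0 0 (- \<i> * om 3)"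
    by (simp add: D_def mat2_mult algebra_simps om2)
  have "psl (D ** shift 1 ** matrix_inv D) \<in> ?H"
    using D_in by (intro mult T inv) (simp_all add: D det_mul inv_psl algebra_simps om2)
  moreover have "D ** shift 1 ** matrix_inv D = shift (om 3)"
    unfolding D by (subst matrix_inv_mat2) (simp_all add: mat2_mult algebra_simps om2)
  ultimately have U: "psl (shift (om 3)) \<in> ?H" by simp
  have sub: "PSL2_O 3 \<subseteq> ?H" by (rule PSL2_O_subset_if_generators[OF _ H S T U]) simp
  have "PGL2_O 3 \<subseteq> ?H"
  proof
    fix x assume "x \<in> PGL2_O 3"
    then obtain A l where A: "x = psl A" "det A = 1" "l ^ 4 = 1" "scaled_over l (ring_of_ints 3) A"
      unfolding PGL2_O_3_eq by blast
    have one: "psl B \<in> ?H"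
      if B: "det B = 1" "scaled_over m (ring_of_ints 3) B" and m: "m = 1 \<or> m = - 1" for m B
    proof -
      obtain a b c e where O: "{a, b, c, e} \<subseteq> ring_of_ints 3"
        and B': "B = mat2 (m * a) (m * b) (m * c) (m * e)" using B by (auto simp: scaled_over_def)
      have "scaled_over 1 (ring_of_ints 3) B"
        unfolding scaled_over_def
        by (rule exI[of _ "m * a"], rule exI[of _ "m * b"], rule exI[of _ "m * c"], rule exI[of _ "m * e"])
           (use O m in \<open>auto simp: B' intro: R\<close>)
      hence "psl B \<in> PSL2_O 3" using B(1) unfolding PSL2_O_eq by blast
      thus ?thesis using sub by blast
    qed
    from fourth_root_of_unity_square[OF A(3)] show "x \<in> ?H"
    proof
      assume "l\<^sup>2 = 1"
      hence "l = 1 \<or> l = - 1" by (simp add: power2_eq_1_iff)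
      thus ?thesis using one A by blast
    next
      assume "l\<^sup>2 = - 1"
      hence "(l * \<i>)\<^sup>2 = 1" by (simp add: power_mult_distrib)
      hence li: "l * \<i> = 1 \<or> l * \<i> = - 1" by (simp add: power2_eq_1_iff)
      define Y where "Y = mat2 (\<i> * om 3) \<i> \<i> 0"
      have dY: "det Y = 1" by (simp add: Y_def)
      have "scaled_over (l * \<i>) (ring_of_ints 3) (A ** matrix_inv Y)"
        using scY A dY by (intro scaled_over_mult R0 scaled_over_matrix_inv) (simp_all add: Y_def)
      moreover have AY: "det (A ** matrix_inv Y) = 1" using A dY by (simp add: det_mul inv_psl)
      ultimately have "psl (A ** matrix_inv Y) \<in> ?H" using one li by blast
      moreover have "psl Y \<in> ?H" unfolding Y_def by (rule Y)
      ultimately have "psl (A ** matrix_inv Y ** Y) \<in> ?H"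
        using AY dY by (rule mult)
      moreover have "A ** matrix_inv Y ** Y = A"
        using dY by (simp add: matrix_mul_assoc[symmetric] matrix_inv_cmat2(1) invertible_det_nz)
      ultimately show ?thesis using A by simp
    qed
  qed
  with \<open>?H \<subseteq> PGL2_O 3\<close> show "?H = PGL2_O 3" by blast
qed

lemma scaled_if_psl_in_PSL2_O:
  assumes "d \<in> {3, 7, 11}" "det A = 1" "psl A \<in> PSL2_O d"
  shows "\<exists>l. l ^ 4 = 1 \<and> scaled_over l (ring_of_ints d) A"
  using assms(3) unfolding PSL2_O_eq psl_image_scaled_iff[OF subring_ring_of_ints[OF assms(1)] assms(2)]
  by (intro exI[of _ 1]) auto

lemma scaled_if_psl_in_PGL2_O_3:
  assumes "det A = 1" "psl A \<in> PGL2_O 3"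
  shows "\<exists>l. l ^ 4 = 1 \<and> scaled_over l (ring_of_ints 3) A"
proof -
  have "subring_of_complex (ring_of_ints 3)" by (rule subring_ring_of_ints) simp
  from psl_image_scaled_iff[OF this assms(1)] show ?thesis
    using assms(2) unfolding PGL2_O_3_eq by blast
qed

lemma jorgensen_parabolic_type_PSL2_O:
  assumes "d \<in> {3, 7, 11}"
  shows "jorgensen_parabolic_type (PSL2_O d)"
  by (rule jorgensen_parabolic_typeI[OF assms PSL2_O_generated[OF assms, symmetric]])
     (use scaled_if_psl_in_PSL2_O[OF assms] in auto)

lemma jorgensen_parabolic_type_PGL2_O_3: "jorgensen_parabolic_type (PGL2_O 3)"
  by (rule jorgensen_parabolic_typeI[OF _ PGL2_O_3_generated[symmetric], of 3])
     (use scaled_if_psl_in_PGL2_O_3 PSL2_O_3_subset_PGL2_O_3 in auto)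

section \<open>Conjugate subgroups\<close>

lemma conjugate_subgroups_traces:
  assumes G: "subgroup G PSL2C" and conj: "conjugate_subgroups G H"
  shows "\<And>A. det A = 1 \<Longrightarrow> psl A \<in> G \<Longrightarrow> \<exists>B. det B = 1 \<and> psl B \<in> H \<and> trace B = trace A"
    and "\<And>B. det B = 1 \<Longrightarrow> psl B \<in> H \<Longrightarrow> \<exists>A. det A = 1 \<and> psl A \<in> G \<and> trace A = trace B"
proof -
  interpret group PSL2C by (rule group_PSL2C)
  obtain P where P: "det P = 1"
    and H: "H = (\<lambda>x. psl P \<otimes>\<^bsub>PSL2C\<^esub> x \<otimes>\<^bsub>PSL2C\<^esub> inv\<^bsub>PSL2C\<^esub> psl P) ` G"
    using conj by (auto simp: conjugate_subgroups_def carrier_PSL2C)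
  have e: "psl P \<otimes>\<^bsub>PSL2C\<^esub> psl A \<otimes>\<^bsub>PSL2C\<^esub> inv\<^bsub>PSL2C\<^esub> psl P = psl (P ** A ** matrix_inv P)"
    if "det A = 1" for A
    using P that by (simp add: inv_psl psl_mult det_mul)
  have tr: "trace (P ** A ** matrix_inv P) = trace A" for A
  proof -
    have "trace (P ** A ** matrix_inv P) = trace (matrix_inv P ** P ** A)"
      by (subst trace_mul_sym) (simp add: matrix_mul_assoc)
    thus ?thesis using P by (simp add: matrix_inv_cmat2(1) invertible_det_nz)
  qed
  show "\<exists>B. det B = 1 \<and> psl B \<in> H \<and> trace B = trace A" if "det A = 1" "psl A \<in> G" for A
  proof (intro exI conjI)
    show "det (P ** A ** matrix_inv P) = 1" using P that by (simp add: det_mul inv_psl)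
    show "psl (P ** A ** matrix_inv P) \<in> H" unfolding H e[OF that(1), symmetric] using that(2) by blast
  qed (rule tr)
  show "\<exists>A. det A = 1 \<and> psl A \<in> G \<and> trace A = trace B" if B: "det B = 1" "psl B \<in> H" for B
  proof -
    obtain x where x: "x \<in> G" "psl B = psl P \<otimes>\<^bsub>PSL2C\<^esub> x \<otimes>\<^bsub>PSL2C\<^esub> inv\<^bsub>PSL2C\<^esub> psl P"
      using B(2) unfolding H by blast
    have "x \<in> carrier PSL2C" using x(1) subgroup.subset[OF G] by blast
    then obtain A where A: "x = psl A" "det A = 1" by (auto simp: carrier_PSL2C)
    have "psl B = psl (P ** A ** matrix_inv P)" using x(2) e A by simp
    hence "B = P ** A ** matrix_inv P \<or> B = - (P ** A ** matrix_inv P)" by (simp only: psl_eq_iff)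
    thus ?thesis
    proof
      assume "B = P ** A ** matrix_inv P"
      thus ?thesis using A x(1) tr by (intro exI[of _ A]) simp
    next
      assume "B = - (P ** A ** matrix_inv P)"
      hence "trace (- A) = trace B" by (simp add: trace_uminus_cmat2 tr)
      moreover have "det (- A) = 1" "psl (- A) \<in> G" using A x(1) by (simp_all add: psl_uminus)
      ultimately show ?thesis by blast
    qed
  qed
qed

section \<open>Arithmetic obstructions\<close>

text \<open>Otherwise \<open>r = a / (d b)\<close> satisfies \<open>d r\<^sup>2 = 1\<close>, so \<open>r\<close> is an integer and \<open>d\<close> divides 1.\<close>

lemma int_eq_int_times_sqrt_imp_0:
  assumes d: "d \<in> {3, 7, 11}" and e: "real_of_int a = of_int b * sqrt (real d)"
  shows "b = 0"
proof (rule ccontr)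
  assume b: "b \<noteq> 0"
  define r :: rat where "r = of_int a / (of_nat d * of_int b)"
  have "(real_of_int a)\<^sup>2 = (of_int b)\<^sup>2 * real d" unfolding e by (simp add: power_mult_distrib)
  hence "real_of_int (a\<^sup>2) = real_of_int (b\<^sup>2 * int d)" by simp
  hence "a\<^sup>2 = b\<^sup>2 * int d" by (simp only: of_int_eq_iff)
  hence "(of_int a :: rat)\<^sup>2 = (of_int b)\<^sup>2 * of_nat d"
    by (metis of_int_mult of_int_of_nat_eq of_int_power)
  hence one: "of_nat d * r\<^sup>2 = 1"
    using b d by (auto simp: r_def power_divide power_mult_distrib power2_eq_square)
  have "prime d" using d by auto
  hence "r \<in> \<int>" by (rule sqrt_rational_multiple_int) (simp add: one)
  then obtain k where "r = of_int k" by (elim Ints_cases)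
  hence "of_int (int d * k\<^sup>2) = (of_int 1 :: rat)" using one by simp
  hence "int d * k\<^sup>2 = 1" by (simp only: of_int_eq_iff)
  hence "int d dvd 1" by (metis dvd_triv_left)
  thus False using d by auto
qed

text \<open>The quadratic field does not contain \<open>i\<close>, so \<open>O\<close> and \<open>i O\<close> meet only in 0.\<close>

lemma ring_of_ints_Int_ii_times:
  assumes d: "d \<in> {3, 7, 11}" and x: "x \<in> ring_of_ints d" and y: "y \<in> ring_of_ints d"
    and xy: "x = l * y" and l: "l\<^sup>2 = - 1"
  shows "x = 0"
proof -
  have "l = \<i> \<or> l = - \<i>" using l by (metis power2_eq_iff power2_i)
  hence "x = \<i> * y \<or> x = \<i> * (- y)" using xy by auto
  then obtain y' where y': "y' \<in> ring_of_ints d" "x = \<i> * y'"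
    using y subring_of_complexD(3)[OF subring_ring_of_ints[OF d] y] by blast
  obtain m n m' n' where mn: "x = of_int m + of_int n * om d" "y' = of_int m' + of_int n' * om d"
    using x y'(1) unfolding ring_of_ints_iff[OF d] by blast
  have "Re x = - Im y'" "Im x = Re y'" by (simp_all add: y'(2))
  hence "real_of_int (2 * m + n) = of_int (- n') * sqrt (real d)"
    and "real_of_int (2 * m' + n') = of_int n * sqrt (real d)"
    by (simp_all add: mn field_simps)
  hence "n' = 0" "n = 0" "2 * m + n = 0"
    using int_eq_int_times_sqrt_imp_0[OF d] by (fastforce, blast, fastforce)
  thus ?thesis by (simp add: mn)
qed

text \<open>Two of the three numbers \<open>t\<close>, \<open>t + c\<close>, \<open>t + 2 c\<close> lie in the same one of \<open>O\<close> and \<open>i O\<close>.  If these are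
  the outer two and the middle one lies in the other set, then \<open>2 (t + c)\<close> lies in both, so
  \<open>t + c = 0\<close>.\<close>

lemma same_scale_of_translates:
  assumes d: "d \<in> {3, 7, 11}"
    and n: "\<And>n::nat. n \<le> 2 \<Longrightarrow> \<exists>l x. l ^ 4 = 1 \<and> x \<in> ring_of_ints d \<and> t + of_nat n * c = l * x"
  shows "\<exists>l w u. l ^ 4 = 1 \<and> w \<in> ring_of_ints d \<and> u \<in> ring_of_ints d \<and> t = l * w \<and> c = l * u"
proof -
  note R = subring_of_complexD[OF subring_ring_of_ints[OF d]]
  let ?O = "ring_of_ints d"
  have P: "\<exists>x\<in>?O. t + of_nat n * c = x \<or> t + of_nat n * c = \<i> * x" if n2: "n \<le> 2" for n :: nat
  proof -
    obtain l x where l: "l ^ 4 = 1" "x \<in> ?O" "t + of_nat n * c = l * x" using n[OF n2] by blast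
    have "l = 1 \<or> l = - 1 \<or> l = \<i> \<or> l = - \<i>"
      using fourth_root_of_unity_square[OF l(1)] by (metis power2_eq_1_iff power2_eq_iff power2_i)
    thus ?thesis using l(2,3) R(3)[OF l(2)] by (metis mult_1 mult_minus_left mult_minus_right)
  qed
  obtain x where x: "x \<in> ?O" "t = x \<or> t = \<i> * x" using P[of 0] by auto
  obtain y where y: "y \<in> ?O" "t + c = y \<or> t + c = \<i> * y" using P[of 1] by auto
  obtain z where z: "z \<in> ?O" "t + 2 * c = z \<or> t + 2 * c = \<i> * z" using P[of 2] by auto
  have same: ?thesis if "t = l * a" "t + c = l * b" "a \<in> ?O" "b \<in> ?O" "l ^ 4 = 1" for l a b
  proof -
    have "c = l * (b - a)" using that(1,2) by (simp add: algebra_simps)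
    thus ?thesis using that(1,3,4,5) R(6) by blast
  qed
  have same2: ?thesis if "t + c = l * a" "t + 2 * c = l * b" "a \<in> ?O" "b \<in> ?O" "l ^ 4 = 1" for l a b
  proof -
    have "t = 2 * (t + c) - (t + 2 * c)" by simp
    also have "\<dots> = l * (a - (b - a))" unfolding that(1,2) by (simp add: algebra_simps)
    finally have "t = l * (a - (b - a))" .
    moreover have "a - (b - a) \<in> ?O" using that by (intro R)
    ultimately show ?thesis using same[of l "a - (b - a)" a] that by blast
  qed
  have same3: ?thesis if "t = l * a" "t + c = m * b" "t + 2 * c = l * e" "a \<in> ?O" "b \<in> ?O" "e \<in> ?O"
    "l ^ 4 = 1" "(m = 1 \<and> l = \<i>) \<or> (m = \<i> \<and> l = 1)" for l m a b e
  proof -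
    have "2 * (t + c) = l * (a + e)" using that(1,3) by (simp add: algebra_simps)
    hence "m * (2 * b) = l * (a + e)" using that(2) by (simp add: mult.left_commute)
    hence "- \<i> * (m * (2 * b)) = - \<i> * (l * (a + e))" by simp
    hence "2 * b = - \<i> * (a + e) \<or> 2 * b = \<i> * (a + e)"
      using that(8) \<open>m * (2 * b) = l * (a + e)\<close> by (elim disjE) simp_all
    moreover have "2 * b \<in> ?O" "a + e \<in> ?O" using that by (auto intro: R)
    ultimately have "2 * b = 0"
      using ring_of_ints_Int_ii_times[OF d, of "2 * b" "a + e"] by (metis power2_i power2_minus)
    hence "t + c = l * 0" using that(2) by simp
    thus ?thesis using same[of l a 0] that R(2) by blast
  qed
  have i4: "\<i> ^ 4 = 1" by simp
  have "t = x \<Longrightarrow> t + c = y \<Longrightarrow> ?thesis" using same[of 1 x y] x(1) y(1) by simp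
  moreover have "t = \<i> * x \<Longrightarrow> t + c = \<i> * y \<Longrightarrow> ?thesis"
    using same[of \<i> x y] x(1) y(1) i4 by blast
  moreover have "t + c = y \<Longrightarrow> t + 2 * c = z \<Longrightarrow> ?thesis" using same2[of 1 y z] y(1) z(1) by simp
  moreover have "t + c = \<i> * y \<Longrightarrow> t + 2 * c = \<i> * z \<Longrightarrow> ?thesis"
    using same2[of \<i> y z] y(1) z(1) i4 by blast
  moreover have "t = x \<Longrightarrow> t + c = \<i> * y \<Longrightarrow> t + 2 * c = z \<Longrightarrow> ?thesis"
    using same3[of 1 x \<i> y z] x(1) y(1) z(1) by simp
  moreover have "t = \<i> * x \<Longrightarrow> t + c = y \<Longrightarrow> t + 2 * c = \<i> * z \<Longrightarrow> ?thesis"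
    using same3[of \<i> x 1 y z] x(1) y(1) z(1) i4 by simp
  ultimately show ?thesis using x(2) y(2) z(2) by blast
qed

lemma subring_int_sqrt:
  assumes d: "d \<in> {3, 7, 11}"
  shows "subring_of_complex {of_int a + of_int b * (2 * om d - 1) | a b. True}" (is "subring_of_complex ?R")
  unfolding subring_of_complex_def
proof (intro conjI ballI)
  have sq: "(2 * om d - 1) * (2 * om d - 1) = - of_nat d"
    using d by (auto simp: complex_eq_iff)
  show "1 \<in> ?R" by (rule CollectI, rule exI[of _ 1], rule exI[of _ 0]) simp
  fix x y assume "x \<in> ?R" "y \<in> ?R"
  then obtain a b a' b' where x: "x = of_int a + of_int b * (2 * om d - 1)"
    and y: "y = of_int a' + of_int b' * (2 * om d - 1)" by blast
  have "x + y = of_int (a + a') + of_int (b + b') * (2 * om d - 1)"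
    by (simp add: x y algebra_simps)
  thus "x + y \<in> ?R" by blast
  have "- x = of_int (- a) + of_int (- b) * (2 * om d - 1)" by (simp add: x algebra_simps)
  thus "- x \<in> ?R" by blast
  have "x * y = of_int a * of_int a' + (of_int a * of_int b' + of_int b * of_int a') * (2 * om d - 1)
      + of_int b * of_int b' * ((2 * om d - 1) * (2 * om d - 1))"
    unfolding x y by (simp add: algebra_simps)
  also have "\<dots> = of_int (a * a' - int d * b * b') + of_int (a * b' + b * a') * (2 * om d - 1)"
    unfolding sq by (simp add: algebra_simps)
  finally show "x * y \<in> ?R" by blast
qed

lemma om_coords_unique:
  assumes "d > 0" "of_int a + of_int b * om d = of_int a' + of_int b' * om d"
  shows "a = a' \<and> b = b'"
proof -
  have "real_of_int b * sqrt (real d) / 2 = of_int b' * sqrt (real d) / 2"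
    using arg_cong[OF assms(2), of Im] by simp
  hence "b = b'" using assms(1) by simp
  thus ?thesis using assms(2) by simp
qed

section \<open>An invariant quadratic form modulo 2\<close>

definition two_ideal :: "complex set" where
  "two_ideal = (\<lambda>z. 2 * z) ` ring_of_ints 3"

definition qform :: "complex \<Rightarrow> complex \<Rightarrow> complex \<Rightarrow> complex" where
  "qform g x y = x\<^sup>2 + x * y + g * y\<^sup>2"

text \<open>The matrix \<open>(a, b; c, e)\<close> over \<open>O\<^sub>3\<close> induces an isometry of the form over the field \<open>O\<^sub>3 / 2\<close> with
  four elements.\<close>

definition preserves_qform :: "complex \<Rightarrow> complex \<Rightarrow> complex \<Rightarrow> complex \<Rightarrow> complex \<Rightarrow> bool" where
  "preserves_qform g a b c e \<longleftrightarrow>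
     (\<forall>x\<in>ring_of_ints 3. \<forall>y\<in>ring_of_ints 3.
        qform g (a * x + b * y) (c * x + e * y) - qform g x y \<in> two_ideal)"

lemma subring_ring_of_ints_3: "subring_of_complex (ring_of_ints 3)"
  by (rule subring_ring_of_ints) simp

lemmas ring_of_ints_3_closed = subring_of_complexD[OF subring_ring_of_ints_3]

lemma om_3_in: "om 3 \<in> ring_of_ints 3"
  by (rule om_in_ring_of_ints) simp

lemma two_ideal_I: "z \<in> ring_of_ints 3 \<Longrightarrow> x = 2 * z \<Longrightarrow> x \<in> two_ideal"
  by (auto simp: two_ideal_def)

lemma two_ideal_diff:
  assumes "x \<in> two_ideal" "y \<in> two_ideal"
  shows "x - y \<in> two_ideal"
proof -
  obtain z w where "z \<in> ring_of_ints 3" "x = 2 * z" "w \<in> ring_of_ints 3" "y = 2 * w"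
    using assms by (auto simp: two_ideal_def)
  thus ?thesis by (intro two_ideal_I[of "z - w"] ring_of_ints_3_closed) auto
qed

lemma two_ideal_add:
  assumes "x \<in> two_ideal" "y \<in> two_ideal"
  shows "x + y \<in> two_ideal"
proof -
  obtain z w where "z \<in> ring_of_ints 3" "x = 2 * z" "w \<in> ring_of_ints 3" "y = 2 * w"
    using assms by (auto simp: two_ideal_def)
  thus ?thesis by (intro two_ideal_I[of "z + w"] ring_of_ints_3_closed) auto
qed

lemma preserves_qform_mult:
  assumes A: "preserves_qform g a b c e" and B: "preserves_qform g a' b' c' e'"
    and O: "{a', b', c', e'} \<subseteq> ring_of_ints 3"
  shows "preserves_qform g (a * a' + b * c') (a * b' + b * e') (c * a' + e * c') (c * b' + e * e')"
  unfolding preserves_qform_def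
proof (intro ballI)
  fix x y assume xy: "x \<in> ring_of_ints 3" "y \<in> ring_of_ints 3"
  define p q where "p = a' * x + b' * y" and "q = c' * x + e' * y"
  have "p \<in> ring_of_ints 3" "q \<in> ring_of_ints 3"
    unfolding p_def q_def using O xy by (auto intro!: ring_of_ints_3_closed)
  hence 1: "qform g (a * p + b * q) (c * p + e * q) - qform g p q \<in> two_ideal"
    using A by (simp add: preserves_qform_def)
  have 2: "qform g p q - qform g x y \<in> two_ideal"
    using B xy by (simp add: preserves_qform_def p_def q_def)
  have e: "(a * a' + b * c') * x + (a * b' + b * e') * y = a * p + b * q"
    "(c * a' + e * c') * x + (c * b' + e * e') * y = c * p + e * q"
    by (simp_all add: p_def q_def algebra_simps)
  show "qform g ((a * a' + b * c') * x + (a * b' + b * e') * y)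
      ((c * a' + e * c') * x + (c * b' + e * e') * y) - qform g x y \<in> two_ideal"
    unfolding e using two_ideal_add[OF 1 2] by simp
qed

lemma preserves_qform_adjugate:
  assumes A: "preserves_qform g a b c e" and O: "{a, b, c, e} \<subseteq> ring_of_ints 3"
    and det: "(a * e - b * c)\<^sup>2 = 1"
  shows "preserves_qform g e (- b) (- c) a"
  unfolding preserves_qform_def
proof (intro ballI)
  fix x y assume xy: "x \<in> ring_of_ints 3" "y \<in> ring_of_ints 3"
  define p q where "p = e * x + (- b) * y" and "q = (- c) * x + a * y"
  have "p \<in> ring_of_ints 3" "q \<in> ring_of_ints 3"
    unfolding p_def q_def using O xy by (auto intro!: ring_of_ints_3_closed)
  hence "qform g (a * p + b * q) (c * p + e * q) - qform g p q \<in> two_ideal"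
    using A by (simp add: preserves_qform_def)
  moreover have "a * p + b * q = (a * e - b * c) * x" "c * p + e * q = (a * e - b * c) * y"
    by (simp_all add: p_def q_def algebra_simps)
  moreover have "qform g ((a * e - b * c) * x) ((a * e - b * c) * y)
      = (a * e - b * c)\<^sup>2 * qform g x y"
    by (simp add: qform_def power_mult_distrib) (simp add: algebra_simps power2_eq_square)
  ultimately have "qform g x y - qform g p q \<in> two_ideal" using det by simp
  have "0 \<in> two_ideal" by (rule two_ideal_I[of 0]) (auto intro: ring_of_ints_3_closed)
  from two_ideal_diff[OF this \<open>qform g x y - qform g p q \<in> two_ideal\<close>]
  have "0 - (qform g x y - qform g p q) \<in> two_ideal" .
  thus "qform g (e * x + - b * y) (- c * x + a * y) - qform g x y \<in> two_ideal"
    by (simp add: p_def q_def)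
qed

lemma preserves_qform_shift: "preserves_qform g 1 1 0 1"
  unfolding preserves_qform_def
proof (intro ballI)
  fix x y assume xy: "x \<in> ring_of_ints 3" "y \<in> ring_of_ints 3"
  have "qform g (1 * x + 1 * y) (0 * x + 1 * y) - qform g x y = 2 * (x * y + y * y)"
    by (simp add: qform_def algebra_simps power2_eq_square)
  moreover have "x * y + y * y \<in> ring_of_ints 3" using xy by (intro ring_of_ints_3_closed)
  ultimately show "qform g (1 * x + 1 * y) (0 * x + 1 * y) - qform g x y \<in> two_ideal"
    unfolding two_ideal_def by blast
qed

text \<open>Modulo 2 the matrix is \<open>(m u, v; u, 0)\<close>, since \<open>\<surd>-3\<close> is congruent to 1, and the value of the form
  changes by \<open>(m\<^sup>2 + m) (u x)\<^sup>2\<close>, which is even.  The proof gives half of the exact difference.\<close>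

lemma preserves_qform_second_generator:
  fixes m k :: int
  assumes u: "u \<in> ring_of_ints 3" "v \<in> ring_of_ints 3" "u * v = 1" and k: "k = 1 \<or> k = - 1"
  shows "preserves_qform (v\<^sup>2) (of_int m * (2 * om 3 - 1) * u) (of_int k * v) u 0"
  unfolding preserves_qform_def
proof (intro ballI)
  fix x y assume xy: "x \<in> ring_of_ints 3" "y \<in> ring_of_ints 3"
  define s where "s = 2 * om 3 - 1"
  have s2: "s * s = - 3" by (simp add: s_def algebra_simps om_3_square)
  have sO: "s \<in> ring_of_ints 3" unfolding s_def by (intro ring_of_ints_3_closed om_3_in)
  obtain j where j: "3 * m\<^sup>2 + m = 2 * j" by (metis even_add even_mult_iff even_power evenE odd_numeral pos2)
  obtain i where i: "k - 1 = 2 * i" using k by auto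
  define z where "z = (of_int m * om 3 - of_int j) * (u * x)\<^sup>2 + (of_int (m * k) * s + of_int i) * (x * y)"
  have "qform (v\<^sup>2) (of_int m * s * u * x + of_int k * v * y) (u * x + 0 * y) - qform (v\<^sup>2) x y
     = (of_int m)\<^sup>2 * (s * s) * (u * x)\<^sup>2 + of_int m * s * (u * x)\<^sup>2
       + (2 * of_int (m * k) * s + of_int k) * ((u * v) * (x * y)) - x * y
       + (of_int (k\<^sup>2) - 1) * (v * y)\<^sup>2 + ((u * v)\<^sup>2 - 1) * x\<^sup>2"
    by (simp add: qform_def algebra_simps power2_eq_square)
  also have "\<dots> = (of_int m * s - of_int (3 * m\<^sup>2)) * (u * x)\<^sup>2
      + (2 * of_int (m * k) * s + of_int (k - 1)) * (x * y)"
    using k unfolding s2 u(3) by (auto simp: algebra_simps)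
  also have "of_int m * s - of_int (3 * m\<^sup>2) = 2 * of_int m * om 3 - of_int (3 * m\<^sup>2 + m)"
    by (simp add: s_def algebra_simps)
  also have "(2 * of_int m * om 3 - of_int (3 * m\<^sup>2 + m)) * (u * x)\<^sup>2
      + (2 * of_int (m * k) * s + of_int (k - 1)) * (x * y) = 2 * z"
    unfolding j i z_def by (simp add: algebra_simps)
  finally have "qform (v\<^sup>2) (of_int m * s * u * x + of_int k * v * y) (u * x + 0 * y)
      - qform (v\<^sup>2) x y = 2 * z" .
  moreover have "z \<in> ring_of_ints 3"
    unfolding z_def using xy u by (intro ring_of_ints_3_closed om_3_in sO)
  ultimately show "qform (v\<^sup>2) (of_int m * (2 * om 3 - 1) * u * x + of_int k * v * y) (u * x + 0 * y)
      - qform (v\<^sup>2) x y \<in> two_ideal"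
    unfolding two_ideal_def s_def by blast
qed

lemma even_coords_if_in_two_ideal:
  assumes "of_int p + of_int q * om 3 \<in> two_ideal"
  shows "even p \<and> even q"
proof -
  obtain z where z: "z \<in> ring_of_ints 3" "of_int p + of_int q * om 3 = 2 * z"
    using assms by (auto simp: two_ideal_def)
  obtain m n where "z = of_int m + of_int n * om 3"
    using z(1) ring_of_ints_iff[of 3 z] by auto
  hence "of_int p + of_int q * om 3 = of_int (2 * m) + of_int (2 * n) * om 3"
    using z(2) by (simp add: algebra_simps)
  from om_coords_unique[OF _ this] show ?thesis by simp
qed

lemma mult_om_3_coords:
  "(of_int a + of_int b * om 3) * (of_int c + of_int d * om 3)
   = of_int (a * c - b * d) + of_int (a * d + b * c + b * d) * om 3"
proof -
  have "(of_int a + of_int b * om 3) * (of_int c + of_int d * om 3)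
      = of_int a * of_int c + (of_int a * of_int d + of_int b * of_int c) * om 3
        + of_int b * of_int d * (om 3 * om 3)"
    by (simp add: algebra_simps)
  thus ?thesis unfolding om_3_square by (simp add: algebra_simps)
qed

text \<open>In coordinates with respect to 1 and \<open>\<omega>\<close>, preservation of the form at the two basis vectors and the
  determinant equation become parity conditions on seven integers, which have no solution.\<close>

lemma no_isometry_of_trace_1:
  assumes g: "g = - om 3 \<or> g = om 3 - 1"
    and O: "{a, b, c, e} \<subseteq> ring_of_ints 3"
    and det: "a * e - b * c = 1" and tr: "a + e = 1 \<or> a + e = - 1"
    and Q: "preserves_qform g a b c e"
  shows False
proof -
  have ex: "\<exists>m n. x = of_int m + of_int n * om 3" if "x \<in> ring_of_ints 3" for x
    using that ring_of_ints_iff[of 3 x] by auto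
  obtain a1 a2 where a: "a = of_int a1 + of_int a2 * om 3" using ex[of a] O by auto
  obtain b1 b2 where b: "b = of_int b1 + of_int b2 * om 3" using ex[of b] O by auto
  obtain c1 c2 where c: "c = of_int c1 + of_int c2 * om 3" using ex[of c] O by auto
  obtain k where k: "odd k" "a + e = of_int k"
    using tr by (elim disjE) (auto intro: that[of 1] that[of "- 1"])
  have e: "e = of_int (k - a1) + of_int (- a2) * om 3"
    using k(2) by (simp add: a algebra_simps)
  obtain g1 g2 where g': "g = of_int g1 + of_int g2 * om 3" "odd g2"
    using g by (elim disjE) (auto intro: that[of 0 "-1"] that[of "-1" 1])
  have z: "0 \<in> ring_of_ints 3" "1 \<in> ring_of_ints 3" by (auto intro: ring_of_ints_3_closed)
  have 1: "a * a + a * c + g * (c * c) - 1 \<in> two_ideal"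
    using Q[unfolded preserves_qform_def, rule_format, OF z(2,1)]
    by (simp add: qform_def power2_eq_square)
  have 2: "b * b + b * e + g * (e * e) - g \<in> two_ideal"
    using Q[unfolded preserves_qform_def, rule_format, OF z(1,2)]
    by (simp add: qform_def power2_eq_square)
  have add: "(of_int m + of_int n * om 3) + (of_int m' + of_int n' * om 3)
      = of_int (m + m') + of_int (n + n') * om 3"
    and diff: "(of_int m + of_int n * om 3) - (of_int m' + of_int n' * om 3)
      = of_int (m - m') + of_int (n - n') * om 3" for m n m' n'
    by (simp_all add: algebra_simps)
  have one: "1 = of_int 1 + of_int 0 * om 3" by simp
  note P1 = even_coords_if_in_two_ideal[OF 1[unfolded one a c g'(1) mult_om_3_coords add diff]]
  note P2 = even_coords_if_in_two_ideal[OF 2[unfolded e b g'(1) mult_om_3_coords add diff]]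
  have "a * e - b * c = of_int 1 + of_int 0 * om 3" using det by simp
  note P3 = om_coords_unique[OF _ this[unfolded e a b c mult_om_3_coords diff]]
  have P3': "even (a1 * (k - a1) - a2 * - a2 - (b1 * c1 - b2 * c2) - 1)"
    "even (a1 * - a2 + a2 * (k - a1) + a2 * - a2 - (b1 * c2 + b2 * c1 + b2 * c2))"
    using P3 by simp_all
  show False
    using P1 P2 P3' k(1) g'(2)
    by (simp, argo)
qed

section \<open>Groups of type (\<theta>, k)\<close>

text \<open>The predicate \<open>P\<close> on the entries of the unscaled matrix serves to add invariance of a quadratic form
  to integrality; the translation by \<open>s = i k\<close> moves the second generator of a group of type
  \<open>(\<theta>, k)\<close> to a matrix with a zero on the diagonal.\<close>

definition translated_scaled ::
  "complex \<Rightarrow> complex set \<Rightarrow>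
    (complex \<Rightarrow> complex \<Rightarrow> complex \<Rightarrow> complex \<Rightarrow> bool) \<Rightarrow> cmat2 \<Rightarrow> bool" where
  "translated_scaled s R P A \<longleftrightarrow>
     (\<exists>l a b c e. l ^ 4 = 1 \<and> {a, b, c, e} \<subseteq> R \<and> P a b c e \<and>
        shift s ** A ** shift (- s) = mat2 (l * a) (l * b) (l * c) (l * e))"

lemma translated_scaledI:
  assumes "shift s ** A ** shift (- s) = mat2 (l * a) (l * b) (l * c) (l * e)" "l ^ 4 = 1"
    and "{a, b, c, e} \<subseteq> R" "P a b c e"
  shows "translated_scaled s R P A"
  unfolding translated_scaled_def
  by (rule exI[of _ l], rule exI[of _ a], rule exI[of _ b], rule exI[of _ c], rule exI[of _ e])
     (intro conjI assms)

lemma translated_scaledE: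
  assumes "translated_scaled s R P A"
  obtains l a b c e where "l ^ 4 = 1" "{a, b, c, e} \<subseteq> R" "P a b c e"
    "shift s ** A ** shift (- s) = mat2 (l * a) (l * b) (l * c) (l * e)"
  using assms unfolding translated_scaled_def by (elim exE conjE)

lemma translated_scaled_generate:
  assumes R: "subring_of_complex R"
    and gen: "psl A \<in> generate PSL2C {psl X, psl Y}" "det A = 1" "det X = 1" "det Y = 1"
    and XY: "translated_scaled s R P X" "translated_scaled s R P Y"
    and one: "P 1 0 0 1"
    and mult: "\<And>a b c e a' b' c' e'. P a b c e \<Longrightarrow> P a' b' c' e' \<Longrightarrow> {a', b', c', e'} \<subseteq> R \<Longrightarrow>
        P (a * a' + b * c') (a * b' + b * e') (c * a' + e * c') (c * b' + e * e')"
    and adj: "\<And>a b c e. P a b c e \<Longrightarrow> {a, b, c, e} \<subseteq> R \<Longrightarrow> (a * e - b * c)\<^sup>2 = 1 \<Longrightarrow> P e (- b) (- c) a"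
  shows "translated_scaled s R P A"
proof -
  note R' = subring_of_complexD[OF R]
  have inv_s: "shift (- s) ** shift s = mat 1" by (simp add: mat2_mult mat_eq_mat2)
  have det1: "l * l * (a * e - b * c) = 1"
    if "det A = 1" "shift s ** A ** shift (- s) = mat2 (l * a) (l * b) (l * c) (l * e)" for A l a b c e
    using arg_cong[OF that(2), of det] that(1) by (simp add: det_mul algebra_simps)
  show ?thesis
  proof (rule generate_psl_induct[where P = "translated_scaled s R P", OF gen _ XY])
    have "{1, 0, 0, 1} \<subseteq> R" by (auto intro: R')
    thus "translated_scaled s R P (mat 1)"
      using one
      by (intro translated_scaledI[where l = 1]) (simp_all add: mat2_mult mat_eq_mat2)
  next
    fix A assume "translated_scaled s R P A"
    then obtain l a b c e where l: "l ^ 4 = 1" and abce: "{a, b, c, e} \<subseteq> R" "P a b c e"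
      and A: "shift s ** A ** shift (- s) = mat2 (l * a) (l * b) (l * c) (l * e)"
      by (elim translated_scaledE)
    have "shift s ** (- A) ** shift (- s) = mat2 ((- l) * a) ((- l) * b) ((- l) * c) ((- l) * e)"
      by (simp only: matrix_mult_uminus A uminus_mat2) simp
    moreover have "(- l) ^ 4 = 1" using l by simp
    ultimately show "translated_scaled s R P (- A)"
      using abce by (intro translated_scaledI)
  next
    fix A B assume "translated_scaled s R P A" and B0: "translated_scaled s R P B"
    then obtain l a b c e where l: "l ^ 4 = 1" and abce: "{a, b, c, e} \<subseteq> R" "P a b c e"
      and A: "shift s ** A ** shift (- s) = mat2 (l * a) (l * b) (l * c) (l * e)"
      by (elim translated_scaledE)
    obtain l' a' b' c' e' where l': "l' ^ 4 = 1"
      and abce': "{a', b', c', e'} \<subseteq> R" "P a' b' c' e'"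
      and B: "shift s ** B ** shift (- s) = mat2 (l' * a') (l' * b') (l' * c') (l' * e')"
      using B0 by (elim translated_scaledE)
    have "shift s ** (A ** B) ** shift (- s)
        = shift s ** A ** (shift (- s) ** shift s) ** B ** shift (- s)"
      unfolding inv_s by (simp add: matrix_mul_assoc)
    also have "\<dots> = (shift s ** A ** shift (- s)) ** (shift s ** B ** shift (- s))"
      by (simp only: matrix_mul_assoc)
    also have "\<dots> = mat2 ((l * l') * (a * a' + b * c')) ((l * l') * (a * b' + b * e'))
        ((l * l') * (c * a' + e * c')) ((l * l') * (c * b' + e * e'))"
      unfolding A B mat2_mult by (simp add: distrib_left ac_simps)
    finally have AB: "shift s ** (A ** B) ** shift (- s) = \<dots>" .
    have "(l * l') ^ 4 = 1" using l l' by (simp add: power_mult_distrib)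
    moreover have "{a * a' + b * c', a * b' + b * e', c * a' + e * c', c * b' + e * e'} \<subseteq> R"
      using abce abce' by (auto intro!: R')
    ultimately show "translated_scaled s R P (A ** B)"
      using AB mult[OF abce(2) abce'(2,1)] by (intro translated_scaledI)
  next
    fix A assume dA: "det A = 1" and "translated_scaled s R P A"
    then obtain l a b c e where l: "l ^ 4 = 1" and abce: "{a, b, c, e} \<subseteq> R" "P a b c e"
      and A: "shift s ** A ** shift (- s) = mat2 (l * a) (l * b) (l * c) (l * e)"
      by (elim translated_scaledE)
    have d: "l * l * (a * e - b * c) = 1" by (rule det1[OF dA A])
    have "l ^ 4 * (a * e - b * c)\<^sup>2 = (l * l * (a * e - b * c))\<^sup>2"
      by (simp add: power_mult_distrib flip: power_add)
    hence sq: "(a * e - b * c)\<^sup>2 = 1" using d l by simp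
    have iA: "invertible A" using dA by (simp add: invertible_det_nz)
    have "(shift s ** matrix_inv A ** shift (- s)) ** (shift s ** A ** shift (- s)) =
        shift s ** matrix_inv A ** (shift (- s) ** shift s) ** A ** shift (- s)"
      by (simp only: matrix_mul_assoc)
    also have "\<dots> = shift s ** (matrix_inv A ** A) ** shift (- s)"
      unfolding inv_s by (simp add: matrix_mul_assoc)
    also have "\<dots> = mat 1"
      unfolding matrix_inv_cmat2(1)[OF iA] by (simp add: mat2_mult mat_eq_mat2)
    finally have m: "(shift s ** matrix_inv A ** shift (- s)) ** mat2 (l * a) (l * b) (l * c) (l * e) = mat 1"
      unfolding A .
    have m': "mat2 (l * a) (l * b) (l * c) (l * e) ** mat2 (l * e) (l * - b) (l * - c) (l * a) = mat 1"
      using d by (simp add: mat2_mult mat_eq_mat2 algebra_simps)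
    have "shift s ** matrix_inv A ** shift (- s) = mat2 (l * e) (l * - b) (l * - c) (l * a)"
      using arg_cong[OF m, of "\<lambda>M. M ** mat2 (l * e) (l * - b) (l * - c) (l * a)"]
      by (simp only: matrix_mul_assoc[symmetric] m' matrix_mul_lid matrix_mul_rid)
    moreover have "{e, - b, - c, a} \<subseteq> R" using abce by (auto intro: R')
    ultimately show "translated_scaled s R P (matrix_inv A)"
      using l adj[OF abce(2,1) sq] by (intro translated_scaledI)
  qed
qed

lemma trace_translated:
  "trace (shift s ** A ** shift (- s)) = trace A"
  by (rule cmat2_cases[of A]) (simp add: mat2_mult algebra_simps)

text \<open>The second generator is brought into the normal form \<open>l (m \<surd>-d u, \<plusminus> u\<^sup>-\<^sup>1; u, 0)\<close> with a unit \<open>u\<close>.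
  For \<open>u = \<plusminus>1\<close> the trace \<open>\<omega>\<close> is the obstruction, and for the other units, which exist only for
  \<open>d = 3\<close>, the trace 1.\<close>

lemma not_conjugate_to_params_type:
  assumes d: "d \<in> {3, 7, 11}" and G: "subgroup G PSL2C" and sub: "PSL2_O d \<subseteq> G"
    and scaled: "\<And>A. det A = 1 \<Longrightarrow> psl A \<in> G \<Longrightarrow> \<exists>l. l ^ 4 = 1 \<and> scaled_over l (ring_of_ints d) A"
    and type: "jorgensen_parabolic_type_params \<theta> k H" and conj: "conjugate_subgroups G H"
  shows False
proof -
  note R0 = subring_ring_of_ints[OF d]
  note R = subring_of_complexD[OF R0]
  let ?O = "ring_of_ints d"
  define \<rho> where "\<rho> = exp (\<i> * of_real \<theta>)"
  define \<sigma> where "\<sigma> = exp (- (\<i> * of_real \<theta>))"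
  have \<rho>\<sigma>: "\<rho> * \<sigma> = 1" by (simp add: \<rho>_def \<sigma>_def exp_minus)
  have n\<rho>: "cmod \<rho> = 1" by (simp add: \<rho>_def)
  define \<kappa> where "\<kappa> = complex_of_real k"
  define c where "c = - \<i> * \<rho>"
  define \<beta> where "\<beta> = \<i> * \<kappa>\<^sup>2 * \<rho> - \<i> * \<sigma>"
  define B where "B = mat2 (\<kappa> * \<rho>) \<beta> c (\<kappa> * \<rho>)"
  have H: "H = generate PSL2C {psl (shift 1), psl B}"
    using type by (simp add: jorgensen_parabolic_type_params_def B_def c_def \<beta>_def \<kappa>_def \<rho>_def \<sigma>_def)
  have dB: "det B = 1"
    unfolding B_def c_def \<beta>_def det_mat2 using \<rho>\<sigma> by (simp add: algebra_simps power2_eq_square)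
  have Hs: "subgroup H PSL2C"
    unfolding H by (rule group.generate_is_subgroup[OF group_PSL2C]) (use dB in \<open>auto simp: carrier_PSL2C\<close>)
  have TB: "psl (shift 1) \<in> H" "psl B \<in> H" unfolding H by (auto intro: generate.incl)
  have mult: "psl (A ** B) \<in> H" if "psl A \<in> H" "psl B \<in> H" "det A = 1" "det B = 1" for A B
    using subgroup.m_closed[OF Hs that(1,2)] that by (simp add: psl_mult)
  have trace_H: "\<exists>l x. l ^ 4 = 1 \<and> x \<in> ?O \<and> trace A = l * x" if A: "det A = 1" "psl A \<in> H" for A
  proof -
    obtain A' where "det A' = 1" "psl A' \<in> G" "trace A' = trace A"
      using conjugate_subgroups_traces(2)[OF G conj A] by blast
    moreover obtain l where "l ^ 4 = 1" "scaled_over l ?O A'" using scaled calculation by blast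
    then obtain a b c e where "{a, b, c, e} \<subseteq> ?O" "A' = mat2 (l * a) (l * b) (l * c) (l * e)"
      unfolding scaled_over_def by blast
    ultimately show ?thesis using \<open>l ^ 4 = 1\<close>
      by (intro exI[of _ l] exI[of _ "a + e"]) (auto intro: R simp: algebra_simps)
  qed
  define t where "t = 2 * \<kappa> * \<rho>"
  have "\<exists>l x. l ^ 4 = 1 \<and> x \<in> ?O \<and> t + of_nat n * c = l * x" if "n \<le> 2" for n :: nat
  proof -
    have shift_n: "psl (shift (of_nat n)) \<in> H" for n
    proof (induction n)
      case 0
      show ?case using subgroup.one_closed[OF Hs] by (simp add: psl_one mat_eq_mat2)
    next
      case (Suc n)
      have "psl (shift (of_nat n) ** shift 1) \<in> H" by (intro mult Suc TB) simp_all
      thus ?case by (simp add: mat2_mult add.commute)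
    qed
    have "trace (shift (of_nat n) ** B) = t + of_nat n * c"
      by (simp add: B_def t_def mat2_mult algebra_simps)
    moreover have "psl (shift (of_nat n) ** B) \<in> H" "det (shift (of_nat n) ** B) = 1"
      using dB by (auto intro!: mult shift_n TB simp: det_mul)
    ultimately show ?thesis using trace_H by metis
  qed
  then obtain l w u where l: "l ^ 4 = 1" and w: "w \<in> ?O" "t = l * w" and u: "u \<in> ?O" "c = l * u"
    using same_scale_of_translates[OF d, of t c] by blast
  have nl: "cmod l = 1"
  proof -
    have "cmod (l\<^sup>2) = 1" using fourth_root_of_unity_square[OF l] by auto
    hence "(cmod l)\<^sup>2 = 1\<^sup>2" by (simp add: norm_power)
    thus ?thesis by (rule power2_eq_imp_eq) simp_all
  qed
  have nu: "cmod u = 1"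
    using arg_cong[OF u(2), of cmod] nl n\<rho> by (simp add: c_def norm_mult)
  \<comment> \<open>\<open>v\<close> is the inverse of the unit \<open>u\<close>\<close>
  define v where "v = cnj u"
  have uv: "u * v = 1" using nu by (simp add: v_def complex_norm_square[symmetric])
  have v: "v \<in> ?O"
  proof -
    obtain m n where "u = of_int m + of_int n * om d" using u(1) unfolding ring_of_ints_iff[OF d] by blast
    hence "v = of_int m + of_int n * (1 - om d)" by (simp add: v_def cnj_om)
    thus ?thesis by (auto intro!: R om_in_ring_of_ints[OF d])
  qed
  have l0: "l \<noteq> 0" using nl by auto
  have "t = 2 * \<i> * \<kappa> * c" by (simp add: t_def c_def)
  hence "l * w = l * (2 * \<i> * \<kappa> * u)" unfolding w(2) u(2) by (simp add: ac_simps)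
  hence "w = 2 * \<i> * \<kappa> * u" using l0 by simp
  hence wv: "w * v = 2 * \<i> * \<kappa>" using uv by (simp add: mult.assoc)
  \<comment> \<open>\<open>2 \<omega> - 1 = \<surd>-d\<close>, and \<open>w v = 2 i k\<close> is purely imaginary\<close>
  obtain m where m: "w = of_int m * (2 * om d - 1) * u"
  proof -
    have "w * v \<in> ?O" by (intro R w v)
    then obtain p q where pq: "w * v = of_int p + of_int q * om d"
      unfolding ring_of_ints_iff[OF d] by blast
    have "Re (w * v) = 0" unfolding wv by (simp add: \<kappa>_def)
    hence "real_of_int (2 * p + q) = of_int 0" unfolding pq by simp
    hence "q = - 2 * p" unfolding of_int_eq_iff by simp
    hence "w * v = of_int (- p) * (2 * om d - 1)" unfolding pq by (simp add: algebra_simps)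
    hence "w * v * u = of_int (- p) * (2 * om d - 1) * u" by simp
    moreover have "w * v * u = w" using uv by (simp add: mult.assoc mult.commute)
    ultimately show ?thesis using that by metis
  qed
  obtain \<epsilon> :: int where \<epsilon>: "\<epsilon> = 1 \<or> \<epsilon> = - 1" and l\<epsilon>: "l\<^sup>2 = - of_int \<epsilon>"
    using fourth_root_of_unity_square[OF l] by (elim disjE) (auto intro: that[of 1] that[of "- 1"])
  have B': "shift (\<i> * \<kappa>) ** B ** shift (- (\<i> * \<kappa>))
      = mat2 (l * (of_int m * (2 * om d - 1) * u)) (l * (of_int \<epsilon> * v)) (l * u) (l * 0)"
  proof -
    have lv: "l * (of_int \<epsilon> * v) = - (l ^ 3 * v)"
      by (simp add: power3_eq_cube l\<epsilon>[unfolded power2_eq_square] mult.assoc[symmetric])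
    have "l ^ 3 * v * c = 1"
      using l uv unfolding u(2) by (simp add: power3_eq_cube power4_eq_xxxx algebra_simps)
    moreover have "c * (\<i> * \<sigma>) = - (\<i> * \<i>) * (\<rho> * \<sigma>)" by (simp only: c_def ac_simps mult_minus_left mult_minus_right)
    hence "c * (\<i> * \<sigma>) = 1" using \<rho>\<sigma> by simp
    ultimately have "l ^ 3 * v = \<i> * \<sigma>" by (metis mult.assoc mult.left_neutral mult.right_neutral)
    hence "l * (of_int \<epsilon> * v) = - \<i> * \<sigma>" using lv by simp
    moreover have "l * (of_int m * (2 * om d - 1) * u) = 2 * \<kappa> * \<rho>" using w(2) m by (simp add: t_def)
    moreover have "l * u = - \<i> * \<rho>" using u(2) by (simp add: c_def)
    ultimately show ?thesis
      by (simp only:) (simp add: B_def c_def \<beta>_def mat2_mult algebra_simps power2_eq_square)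
  qed
  have T': "shift (\<i> * \<kappa>) ** shift 1 ** shift (- (\<i> * \<kappa>)) = mat2 (1 * 1) (1 * 1) (1 * 0) (1 * 1)"
    by (simp add: mat2_mult)
  have G_trace: "\<exists>A. det A = 1 \<and> psl A \<in> H \<and> trace A = x" if "x \<in> ?O" for x
  proof -
    have "scaled_over 1 ?O (mat2 x (- 1) 1 0)"
      unfolding scaled_over_def using that
      by (intro exI[of _ x] exI[of _ "- 1"] exI[of _ 1] exI[of _ 0]) (auto intro: R)
    hence "psl (mat2 x (- 1) 1 0) \<in> PSL2_O d" unfolding PSL2_O_eq by (auto intro!: imageI simp del: mat2_inject)
    thus ?thesis using conjugate_subgroups_traces(1)[OF G conj, of "mat2 x (- 1) 1 0"] sub by auto
  qed
  consider (A) "u = 1 \<or> u = - 1" | (B) "d = 3" "u \<in> {om 3, - om 3, 1 - om 3, - (1 - om 3)}"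
    using ring_of_ints_unit_cases[OF d u(1) nu] by blast
  thus False
  proof cases
    case A
    define Z where "Z = {of_int a + of_int b * (2 * om d - 1) | a b. True}"
    have Z0: "subring_of_complex Z" unfolding Z_def by (rule subring_int_sqrt[OF d])
    note Z' = subring_of_complexD[OF Z0]
    have Z_mem: "of_int a + of_int b * (2 * om d - 1) \<in> Z" for a b by (auto simp: Z_def)
    have Z_sub: "Z \<subseteq> ?O"
      unfolding Z_def by (auto intro!: R om_in_ring_of_ints[OF d])
    have "of_int m * (2 * om d - 1) \<in> Z" using Z_mem[of 0 m] by simp
    moreover have "u \<in> Z" "v \<in> Z" using A Z'(1) Z'(3)[OF Z'(1)] by (auto simp: v_def)
    ultimately have mem: "{of_int m * (2 * om d - 1) * u, of_int \<epsilon> * v, u, 0} \<subseteq> Z"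
      by (auto intro!: Z')
    \<comment> \<open>\<open>Z = \<int>[\<surd>-d]\<close> contains the entries of both translated generators, up to the scalar\<close>
    have "translated_scaled (\<i> * \<kappa>) Z (\<lambda>_ _ _ _. True) B"
      using B' l mem by (intro translated_scaledI) simp_all
    moreover have "translated_scaled (\<i> * \<kappa>) Z (\<lambda>_ _ _ _. True) (shift 1)"
      by (rule translated_scaledI[OF T']) (auto intro: Z')
    moreover obtain E where E: "det E = 1" "psl E \<in> H" "trace E = om d"
      using G_trace[OF om_in_ring_of_ints[OF d]] by blast
    ultimately have "translated_scaled (\<i> * \<kappa>) Z (\<lambda>_ _ _ _. True) E"
      using dB unfolding H by (intro translated_scaled_generate[OF Z0, of E "shift 1" B]) auto
    then obtain j a b c' e where j: "j ^ 4 = 1" "{a, b, c', e} \<subseteq> Z"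
      and E': "shift (\<i> * \<kappa>) ** E ** shift (- (\<i> * \<kappa>)) = mat2 (j * a) (j * b) (j * c') (j * e)"
      by (elim translated_scaledE)
    define r where "r = a + e"
    have r: "r \<in> Z" unfolding r_def using j(2) by (intro Z') auto
    have jr: "om d = j * r"
      using arg_cong[OF E', of trace] unfolding trace_translated E(3) by (simp add: r_def algebra_simps)
    from fourth_root_of_unity_square[OF j(1)] show False
    proof
      assume "j\<^sup>2 = - 1"
      hence "om d = 0"
        using ring_of_ints_Int_ii_times[OF d om_in_ring_of_ints[OF d] _ jr] r Z_sub by blast
      hence "Re (om d) = 0" by simp
      thus False by simp
    next
      assume "j\<^sup>2 = 1"
      hence "j = 1 \<or> j = - 1" by (simp add: power2_eq_1_iff)
      hence "om d \<in> Z" using jr r Z'(3)[OF r] by auto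
      then obtain p q where "om d = of_int p + of_int q * (2 * om d - 1)" unfolding Z_def by blast
      from arg_cong[OF this, of Re] have "1 / 2 = real_of_int p" by simp
      hence "real_of_int 1 = of_int (2 * p)" by simp
      thus False unfolding of_int_eq_iff by presburger
    qed
  next
    case B
    have d3: "d = 3" by fact
    have vg: "v\<^sup>2 = - om 3 \<or> v\<^sup>2 = om 3 - 1"
    proof -
      have "v = 1 - om 3 \<or> v = - (1 - om 3) \<or> v = om 3 \<or> v = - om 3"
        using B(2) unfolding v_def by (elim insertE emptyE) (simp_all add: cnj_om)
      moreover have "(1 - om 3)\<^sup>2 = - om 3" "(om 3)\<^sup>2 = om 3 - 1"
        by (simp_all add: power2_eq_square algebra_simps om_3_square)
      ultimately show ?thesis by (elim disjE) (simp_all only: power2_minus, simp_all)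
    qed
    let ?P = "preserves_qform (v\<^sup>2)"
    have "?P (of_int m * (2 * om 3 - 1) * u) (of_int \<epsilon> * v) u 0"
      using preserves_qform_second_generator[OF u(1)[unfolded d3] v[unfolded d3] uv \<epsilon>] .
    moreover have "{of_int m * (2 * om 3 - 1) * u, of_int \<epsilon> * v, u, 0} \<subseteq> ?O"
      using u(1) v unfolding d3 by (auto intro!: ring_of_ints_3_closed om_3_in)
    ultimately have "translated_scaled (\<i> * \<kappa>) ?O ?P B"
      using B' l unfolding d3 by (intro translated_scaledI)
    moreover have "translated_scaled (\<i> * \<kappa>) ?O ?P (shift 1)"
      by (rule translated_scaledI[OF T']) (auto intro: R preserves_qform_shift)
    moreover obtain E where E: "det E = 1" "psl E \<in> H" "trace E = 1"
      using G_trace[OF R(1)] by blast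
    moreover have "?P 1 0 0 1"
      unfolding preserves_qform_def by (auto intro!: two_ideal_I[of 0] ring_of_ints_3_closed)
    ultimately have "translated_scaled (\<i> * \<kappa>) ?O ?P E"
      using dB unfolding H d3
      by (intro translated_scaled_generate[OF subring_ring_of_ints_3, of E "shift 1" B]
            preserves_qform_mult preserves_qform_adjugate) auto
    then obtain j a b c' e where j: "j ^ 4 = 1" and O: "{a, b, c', e} \<subseteq> ?O" and P: "?P a b c' e"
      and E': "shift (\<i> * \<kappa>) ** E ** shift (- (\<i> * \<kappa>)) = mat2 (j * a) (j * b) (j * c') (j * e)"
      by (elim translated_scaledE)
    have tr: "1 = j * (a + e)"
      using arg_cong[OF E', of trace] unfolding trace_translated E(3) by (simp add: algebra_simps)
    have ae: "a + e \<in> ?O" using O by (intro R) auto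
    have "j\<^sup>2 \<noteq> - 1" using ring_of_ints_Int_ii_times[OF d R(1) ae tr] by auto
    hence j2: "j * j = 1"
      using fourth_root_of_unity_square[OF j] by (simp add: power2_eq_square)
    hence "j = 1 \<or> j = - 1" by (simp add: square_eq_1_iff)
    moreover have "a + e = j" using arg_cong[OF tr, of "\<lambda>x. j * x"] j2 by (simp add: mult.assoc[symmetric])
    ultimately have "a + e = 1 \<or> a + e = - 1" by simp
    moreover have "j * j * (a * e - b * c') = 1"
      using arg_cong[OF E', of det] E(1) by (simp add: det_mul algebra_simps)
    hence "a * e - b * c' = 1" using j2 by simp
    ultimately show False using no_isometry_of_trace_1[OF vg _ _ _ P] O d3 by blast
  qed
qed

lemma kleinian_subgroup: "jorgensen_parabolic_type G \<Longrightarrow> subgroup G PSL2C"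
  by (simp add: jorgensen_parabolic_type_def jorgensen_group_def kleinian_group_def)

theorem mainTheorem4:
  shows "(\<forall>G \<in> {PGL2_O 3, PSL2_O 3, PSL2_O 7, PSL2_O 11}.
            jorgensen_parabolic_type G \<and>
            \<not> (\<exists>\<theta> k H. jorgensen_parabolic_type_params \<theta> k H \<and> conjugate_subgroups G H))
       \<and> \<not> (\<forall>G. jorgensen_parabolic_type G \<longrightarrow>
            (\<exists>\<theta> k H. jorgensen_parabolic_type_params \<theta> k H \<and> conjugate_subgroups G H))"
proof -
  have PSL: "jorgensen_parabolic_type (PSL2_O d) \<and>
      \<not> (\<exists>\<theta> k H. jorgensen_parabolic_type_params \<theta> k H \<and> conjugate_subgroups (PSL2_O d) H)"
    if d: "d \<in> {3, 7, 11}" for d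
    using jorgensen_parabolic_type_PSL2_O[OF d]
      not_conjugate_to_params_type[OF d kleinian_subgroup order_refl scaled_if_psl_in_PSL2_O[OF d]]
    by blast
  have PGL: "jorgensen_parabolic_type (PGL2_O 3) \<and>
      \<not> (\<exists>\<theta> k H. jorgensen_parabolic_type_params \<theta> k H \<and> conjugate_subgroups (PGL2_O 3) H)"
    using jorgensen_parabolic_type_PGL2_O_3
      not_conjugate_to_params_type[OF _ kleinian_subgroup PSL2_O_3_subset_PGL2_O_3
        scaled_if_psl_in_PGL2_O_3]
    by blast
  show ?thesis using PGL PSL[of 3] PSL[of 7] PSL[of 11] by auto
qed

end
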